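(* Let $n,t\ge1$ be integers and $\mathbb R[X]:=\mathbb R[X_1,\ldots,X_n]$. Let $\mathbf F\in\mathcal S_t(\mathbb R[X])$ be a homogeneous polynomial matrix. If $\mathbf F(x)>0$ (positive definite) for all $x\in\mathbb R^n\setminus\{0\}$, then there exists an integer $N>0$ such that $$\Big(\sum_{i=1}^nX_i^2\Big)^N\mathbf F\in\sum\nolimits_t\mathbb R[X]^2.$$
   Context: $\mathcal M_t(\mathbb R[X])$ is the algebra of $t\times t$ matrices over $\mathbb R[X]$ ("polynomial matrices"), and $\mathcal S_t(\mathbb R[X])$ its subset of symmetric matrices. A polynomial matrix is homogeneous of degree $d$ if it has the form $\sum_{|\alpha|=d}\mathbf A_\alpha X^\alpha$ with $\mathbf A_\alpha\in\mathcal M_t(\mathbb R)$. $\sum_t\mathbb R[X]^2$ denotes the set of all finite sums of matrices of the form $\mathbf A^T\mathbf A$ with $\mathbf A\in\mathcal M_t(\mathbb R[X])$. *)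

theory Defs
  imports "HOL-Analysis.Analysis" "HOL-Library.Poly_Mapping"
begin

text \<open>
  The variables are indexed by a finite type \<open>'n\<close>, so a monomial is an exponent vector
  \<open>'n \<Rightarrow>\<^sub>0 nat\<close>, and the ring structure on finitely supported coefficient functions is the
  convolution product of \<^theory>\<open>HOL-Library.Poly_Mapping\<close>. Types are nonempty, hence
  there is at least one variable and matrices have size at least one.
\<close>

type_synonym 'n mpoly = "('n \<Rightarrow>\<^sub>0 nat) \<Rightarrow>\<^sub>0 real"

type_synonym ('n, 't) pmat = "'n mpoly ^ 't ^ 't"

definition mvar :: "'n \<Rightarrow> 'n mpoly" where
  "mvar i = Poly_Mapping.single (Poly_Mapping.single i 1) 1"

definition mpoly_eval :: "'n::finite mpoly \<Rightarrow> real ^ 'n \<Rightarrow> real" where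
  "mpoly_eval p x =
     (\<Sum>\<alpha>\<in>Poly_Mapping.keys p.
        Poly_Mapping.lookup p \<alpha> * (\<Prod>i\<in>UNIV. (x $ i) ^ Poly_Mapping.lookup \<alpha> i))"

definition pmat_eval :: "('n::finite, 't::finite) pmat \<Rightarrow> real ^ 'n \<Rightarrow> real ^ 't ^ 't" where
  "pmat_eval F x = (\<chi> i j. mpoly_eval (F $ i $ j) x)"

definition pmat_scale :: "'n mpoly \<Rightarrow> ('n, 't::finite) pmat \<Rightarrow> ('n, 't) pmat" where
  "pmat_scale p F = (\<chi> i j. p * F $ i $ j)"

definition monom_degree :: "('n::finite \<Rightarrow>\<^sub>0 nat) \<Rightarrow> nat" where
  "monom_degree \<alpha> = (\<Sum>i\<in>UNIV. Poly_Mapping.lookup \<alpha> i)"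

definition pmat_monom :: "real ^ 't ^ 't \<Rightarrow> ('n \<Rightarrow>\<^sub>0 nat) \<Rightarrow> ('n, 't::finite) pmat" where
  "pmat_monom A \<alpha> = (\<chi> i j. Poly_Mapping.single \<alpha> (A $ i $ j))"

definition homogeneous_pmat :: "nat \<Rightarrow> ('n::finite, 't::finite) pmat \<Rightarrow> bool" where
  "homogeneous_pmat d F \<longleftrightarrow>
     (\<exists>A. F = (\<Sum>\<alpha>\<in>{\<alpha>. monom_degree \<alpha> = d}. pmat_monom (A \<alpha>) \<alpha>))"

definition pos_def_matrix :: "real ^ 't ^ 't \<Rightarrow> bool" where
  "pos_def_matrix A \<longleftrightarrow> transpose A = A \<and> (\<forall>v. v \<noteq> 0 \<longrightarrow> v \<bullet> (A *v v) > 0)"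

definition sos_pmats :: "('n, 't::finite) pmat set" where
  "sos_pmats = {(\<Sum>k<m. transpose (A k) ** A k) | (m::nat) (A :: nat \<Rightarrow> ('n, 't) pmat). True}"

text \<open>The index set in \<open>homogeneous_pmat\<close> is finite, so that sum is not vacuously zero.\<close>

lemma finite_monom_degree: "finite {\<alpha> :: 'n::finite \<Rightarrow>\<^sub>0 nat. monom_degree \<alpha> = d}"
proof (rule finite_imageD)
  have "Poly_Mapping.lookup \<alpha> i \<le> d" if "monom_degree \<alpha> = d" for \<alpha> :: "'n \<Rightarrow>\<^sub>0 nat" and i
    using that member_le_sum[of i UNIV "Poly_Mapping.lookup \<alpha>"]
    by (simp add: monom_degree_def)
  then have "Poly_Mapping.lookup ` {\<alpha> :: 'n \<Rightarrow>\<^sub>0 nat. monom_degree \<alpha> = d}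
      \<subseteq> PiE UNIV (\<lambda>_. {..d})"
    by auto
  then show "finite (Poly_Mapping.lookup ` {\<alpha> :: 'n \<Rightarrow>\<^sub>0 nat. monom_degree \<alpha> = d})"
    by (rule finite_subset) (simp add: finite_PiE)
qed (simp add: inj_on_def poly_mapping.lookup_inject)

lemma lookup_sum_pmat_monom:
  "Poly_Mapping.lookup ((\<Sum>\<alpha>\<in>{\<alpha>. monom_degree \<alpha> = d}. pmat_monom (A \<alpha>) \<alpha>) $ i $ j) \<beta>
     = (if monom_degree \<beta> = d then A \<beta> $ i $ j else 0)"
  by (simp add: pmat_monom_def lookup_sum lookup_single when_def finite_monom_degree)

lemma homogeneous_pmat_iff:
  "homogeneous_pmat d F \<longleftrightarrow>
     (\<forall>i j. \<forall>\<alpha>\<in>Poly_Mapping.keys (F $ i $ j). monom_degree \<alpha> = d)"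
proof
  assume "homogeneous_pmat d F"
  then obtain A where F: "F = (\<Sum>\<alpha>\<in>{\<alpha>. monom_degree \<alpha> = d}. pmat_monom (A \<alpha>) \<alpha>)"
    unfolding homogeneous_pmat_def by blast
  show "\<forall>i j. \<forall>\<alpha>\<in>Poly_Mapping.keys (F $ i $ j). monom_degree \<alpha> = d"
    unfolding F in_keys_iff lookup_sum_pmat_monom Ball_def by simp
next
  assume R: "\<forall>i j. \<forall>\<alpha>\<in>Poly_Mapping.keys (F $ i $ j). monom_degree \<alpha> = d"
  let ?A = "\<lambda>\<alpha>. \<chi> i j. Poly_Mapping.lookup (F $ i $ j) \<alpha>"
  have "F $ i $ j = (\<Sum>\<alpha>\<in>{\<alpha>. monom_degree \<alpha> = d}. pmat_monom (?A \<alpha>) \<alpha>) $ i $ j" for i j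
  proof (rule poly_mapping_eqI)
    fix \<beta>
    have "monom_degree \<beta> = d" if "Poly_Mapping.lookup (F $ i $ j) \<beta> \<noteq> 0"
      using R that by (meson in_keys_iff)
    then show "Poly_Mapping.lookup (F $ i $ j) \<beta> = Poly_Mapping.lookup
        ((\<Sum>\<alpha>\<in>{\<alpha>. monom_degree \<alpha> = d}. pmat_monom (?A \<alpha>) \<alpha>) $ i $ j) \<beta>"
      unfolding lookup_sum_pmat_monom by auto
  qed
  then have "F = (\<Sum>\<alpha>\<in>{\<alpha>. monom_degree \<alpha> = d}. pmat_monom (?A \<alpha>) \<alpha>)"
    unfolding vec_eq_iff by blast
  then show "homogeneous_pmat d F"
    unfolding homogeneous_pmat_def by (rule exI[where x = ?A])
qed

end

theory Submission
  imports Defs "HOL-Probability.Probability"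
begin

text \<open>
  The degree is even, say \<open>2k\<close>, since \<open>F(x)\<close> and \<open>F(-x)\<close> are both positive definite. For a form \<open>p\<close> of
  degree \<open>2k\<close> and a standard Gaussian vector \<open>y\<close>, integration by parts gives
  \<open>E (p(y) (y \<bullet> x)\<^bsup>2N+2k\<^esup>) = c\<^sub>N |x|\<^bsup>2N\<^esup> T\<^sub>N p(x)\<close> with \<open>c\<^sub>N > 0\<close> and forms \<open>T\<^sub>N p\<close> of degree \<open>2k\<close>
  whose coefficients converge to those of \<open>p\<close>. If \<open>P\<close> is a symmetric matrix of forms that is positive
  semidefinite at every point, then the left-hand side for \<open>P\<close> has a moment matrix as Gram matrix, so
  \<open>|x|\<^bsup>2N\<^esup> T\<^sub>N P\<close> is a sum of squares. By compactness this applies to \<open>P = F - \<delta> U I\<close> with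
  \<open>U\<close> the sum of the squares of all monomials of degree \<open>k\<close> and some \<open>\<delta> > 0\<close>. For large \<open>N\<close> the remainder
  \<open>F - T\<^sub>N P = \<delta> U I + (P - T\<^sub>N P)\<close> has a diagonally dominant Gram matrix, so it is a sum of
  squares too.
\<close>

alias lookup = Poly_Mapping.lookup
alias single = Poly_Mapping.single
alias keys = Poly_Mapping.keys

text \<open>As a destruction rule this fact loops together with \<open>in_keys_iff\<close>.\<close>

declare lookup_eq_zero_in_keys_contradict [rule del]

subsection \<open>Coefficients and linear functionals\<close>

lemma sum_single_lookup: "(\<Sum>\<alpha>\<in>keys p. single \<alpha> (lookup p \<alpha>)) = p"
  by (rule poly_mapping_eqI) (auto simp: lookup_sum lookup_single when_def in_keys_iff)

text \<open>The linear functional with value \<open>c \<alpha>\<close> on the monomial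
  \<open>X^\<alpha>\<close>. Evaluation at \<open>x\<close> (\<open>c = monom_value x\<close>) and
  Gaussian expectation (\<open>c = gauss_moment\<close>) both have this form.\<close>

definition coeff_pairing :: "('a \<Rightarrow> real) \<Rightarrow> ('a \<Rightarrow>\<^sub>0 real) \<Rightarrow> real" where
  "coeff_pairing c p = (\<Sum>\<alpha>\<in>keys p. lookup p \<alpha> * c \<alpha>)"

lemma coeff_pairing_superset:
  assumes "finite S" "keys p \<subseteq> S"
  shows "coeff_pairing c p = (\<Sum>\<alpha>\<in>S. lookup p \<alpha> * c \<alpha>)"
  unfolding coeff_pairing_def using assms by (intro sum.mono_neutral_left) (auto simp: in_keys_iff)

lemma coeff_pairing_zero [simp]: "coeff_pairing c 0 = 0"
  by (simp add: coeff_pairing_def)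

lemma coeff_pairing_single [simp]: "coeff_pairing c (single \<alpha> a) = a * c \<alpha>"
  by (simp add: coeff_pairing_def)

lemma coeff_pairing_add: "coeff_pairing c (p + q) = coeff_pairing c p + coeff_pairing c q"
proof -
  let ?S = "keys p \<union> keys q"
  have "keys (p + q) \<subseteq> ?S"
    by (auto simp: in_keys_iff lookup_add)
  then show ?thesis
    by (simp add: coeff_pairing_superset[of ?S] lookup_add algebra_simps sum.distrib)
qed

lemma coeff_pairing_sum: "coeff_pairing c (sum f I) = (\<Sum>i\<in>I. coeff_pairing c (f i))"
  by (induction I rule: infinite_finite_induct) (simp_all add: coeff_pairing_add)

lemma single_times_sum:
  "single \<beta> a * p = (\<Sum>\<alpha>\<in>keys p. single (\<beta> + \<alpha>) (a * lookup p \<alpha>))"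
  by (subst (1) sum_single_lookup[of p, symmetric]) (simp add: sum_distrib_left mult_single)

lemma coeff_pairing_single_times:
  "coeff_pairing c (single \<beta> a * p) = a * coeff_pairing (\<lambda>\<alpha>. c (\<beta> + \<alpha>)) p"
  unfolding single_times_sum coeff_pairing_sum coeff_pairing_single
  by (simp add: coeff_pairing_def sum_distrib_left mult.assoc)

lemma lookup_single_times:
  fixes \<beta> :: "'a::cancel_comm_monoid_add"
  shows "lookup (single \<beta> a * p) (\<beta> + \<eta>) = a * lookup p \<eta>"
  by (auto simp: single_times_sum lookup_sum lookup_single when_def in_keys_iff)

lemma lookup_const_times [simp]: "lookup (single 0 a * p) \<eta> = a * lookup p \<eta>"
  for p :: "'n mpoly"
  using lookup_single_times[of 0 a p \<eta>] by simp

lemma unit_exponent_split: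
  assumes "lookup \<eta> i \<noteq> 0"
  shows "single i 1 + (\<eta> - single i 1) = (\<eta> :: 'n \<Rightarrow>\<^sub>0 nat)"
  using assms by (intro poly_mapping_eqI) (auto simp: lookup_add lookup_minus lookup_single when_def)

lemma lookup_mvar_times:
  "lookup (mvar i * p) \<eta> = (if lookup \<eta> i = 0 then 0 else lookup p (\<eta> - single i 1))"
proof (cases "lookup \<eta> i = 0")
  case True
  then have "single i 1 + \<alpha> \<noteq> \<eta>" for \<alpha>
    by (auto simp: lookup_add)
  then show ?thesis
    using True by (simp add: mvar_def single_times_sum lookup_sum lookup_single when_def)
next
  case False
  then show ?thesis
    using lookup_single_times[of "single i 1" 1 p "\<eta> - single i 1"] unit_exponent_split[OF False]
    by (simp add: mvar_def)
qed

section \<open>Degrees and homogeneous polynomials\<close>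

lemma monom_degree_add: "monom_degree (\<alpha> + \<beta>) = monom_degree \<alpha> + monom_degree \<beta>"
  by (simp add: monom_degree_def lookup_add sum.distrib)

lemma monom_degree_zero [simp]: "monom_degree 0 = 0"
  by (simp add: monom_degree_def)

lemma monom_degree_unit [simp]: "monom_degree (single i (Suc 0)) = 1"
  by (simp add: monom_degree_def lookup_single when_def)

lemma monom_degree_eq_0_iff: "monom_degree \<alpha> = 0 \<longleftrightarrow> \<alpha> = 0"
  by (auto simp: monom_degree_def intro!: poly_mapping_eqI)

definition homogeneous :: "nat \<Rightarrow> 'n::finite mpoly \<Rightarrow> bool" where
  "homogeneous d p \<longleftrightarrow> (\<forall>\<alpha>. lookup p \<alpha> \<noteq> 0 \<longrightarrow> monom_degree \<alpha> = d)"

lemma homogeneous_single: "homogeneous d (single \<alpha> a)" if "monom_degree \<alpha> = d"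
  using that by (auto simp: homogeneous_def lookup_single when_def)

lemma homogeneous_add: "homogeneous d p \<Longrightarrow> homogeneous d q \<Longrightarrow> homogeneous d (p + q)"
  unfolding homogeneous_def lookup_add by (metis add_0)

lemma homogeneous_diff: "homogeneous d p \<Longrightarrow> homogeneous d q \<Longrightarrow> homogeneous d (p - q)"
  unfolding homogeneous_def lookup_minus by (metis diff_zero)

lemma homogeneous_zero: "homogeneous d 0"
  by (simp add: homogeneous_def)

lemma homogeneous_sum: "(\<And>i. i \<in> I \<Longrightarrow> homogeneous d (f i)) \<Longrightarrow> homogeneous d (sum f I)"
  by (induction I rule: infinite_finite_induct) (simp_all add: homogeneous_add homogeneous_zero)

lemma homogeneous_const_times: "homogeneous d p \<Longrightarrow> homogeneous d (single 0 a * p)"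
  by (simp add: homogeneous_def)

lemma homogeneous_mvar_times: 
  assumes "homogeneous d p" shows "homogeneous (Suc d) (mvar i * p)"
  unfolding homogeneous_def
proof (intro allI impI)
  fix \<eta> assume "lookup (mvar i * p) \<eta> \<noteq> 0"
  then have "lookup \<eta> i \<noteq> 0" "lookup p (\<eta> - single i 1) \<noteq> 0"
    by (auto simp: lookup_mvar_times split: if_splits)
  then have "monom_degree (\<eta> - single i 1) = d" "single i 1 + (\<eta> - single i 1) = \<eta>"
    using assms unit_exponent_split by (auto simp: homogeneous_def)
  then show "monom_degree \<eta> = Suc d"
    using monom_degree_add[of "single i 1" "\<eta> - single i 1"] by simp
qed

definition norm_square :: "'n::finite mpoly" where
  "norm_square = (\<Sum>i\<in>UNIV. mvar i ^ 2)"

lemma norm_square_times: "norm_square * p = (\<Sum>i\<in>UNIV. mvar i * (mvar i * p))"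
  by (simp add: norm_square_def sum_distrib_right power2_eq_square mult.assoc)

lemma homogeneous_norm_square_times:
  "homogeneous d p \<Longrightarrow> homogeneous (Suc (Suc d)) (norm_square * p)"
  unfolding norm_square_times by (intro homogeneous_sum homogeneous_mvar_times)

text \<open>The multinomial theorem. In the induction step the summand with the extra factor
  \<open>X_i\<close> contributes \<open>K! \<eta>_i / \<eta>!\<close>, and the exponents
  \<open>\<eta>_i\<close> add up to \<open>K + 1\<close>.\<close>

lemma lookup_linear_power:
  "lookup ((\<Sum>i\<in>(UNIV::'n::finite set). mvar i) ^ K) \<eta> =
     (if monom_degree \<eta> = K then fact K / (\<Prod>i\<in>UNIV. fact (lookup \<eta> i)) else 0)"
proof (induction K arbitrary: \<eta>)
  case 0
  show ?case
    by (auto simp: lookup_one monom_degree_eq_0_iff when_def)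
next
  case (Suc K)
  let ?f = "\<lambda>\<eta>::'n \<Rightarrow>\<^sub>0 nat. \<Prod>i\<in>UNIV. fact (lookup \<eta> i) :: real"
  have summand: "lookup (mvar i * (\<Sum>i\<in>UNIV. mvar i) ^ K) \<eta> =
      (if monom_degree \<eta> = Suc K then fact K * real (lookup \<eta> i) / ?f \<eta> else 0)" for i
  proof (cases "lookup \<eta> i = 0")
    case True
    then show ?thesis by (simp add: lookup_mvar_times)
  next
    case False
    let ?\<zeta> = "\<eta> - single i 1"
    have split: "single i 1 + ?\<zeta> = \<eta>"
      using False by (rule unit_exponent_split)
    have deg: "monom_degree \<eta> = Suc (monom_degree ?\<zeta>)"
      using monom_degree_add[of "single i 1" ?\<zeta>] split by simp
    have "?f \<eta> = fact (lookup \<eta> i) * (\<Prod>j\<in>UNIV - {i}. fact (lookup \<eta> j))"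
      by (rule prod.remove) auto
    also have "\<dots> = real (lookup \<eta> i) * (fact (lookup ?\<zeta> i) * (\<Prod>j\<in>UNIV - {i}. fact (lookup ?\<zeta> j)))"
      using False fact_reduce[of "lookup \<eta> i", where 'a = real]
      by (simp add: lookup_minus lookup_single when_def mult.assoc)
    also have "fact (lookup ?\<zeta> i) * (\<Prod>j\<in>UNIV - {i}. fact (lookup ?\<zeta> j)) = ?f ?\<zeta>"
      by (rule prod.remove[symmetric]) auto
    finally have f: "?f \<eta> = real (lookup \<eta> i) * ?f ?\<zeta>" .
    have "lookup (mvar i * (\<Sum>i\<in>UNIV. mvar i) ^ K) \<eta> =
        (if monom_degree ?\<zeta> = K then fact K / ?f ?\<zeta> else 0)"
      using False by (simp add: lookup_mvar_times Suc.IH)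
    then show ?thesis
      using False deg f by simp
  qed
  have "lookup ((\<Sum>i\<in>UNIV. mvar i) ^ Suc K) \<eta> =
      (\<Sum>i\<in>UNIV. lookup (mvar i * (\<Sum>i\<in>UNIV. mvar i) ^ K) \<eta>)"
    by (simp add: sum_distrib_right lookup_sum)
  also have "\<dots> = (if monom_degree \<eta> = Suc K then fact K * real (monom_degree \<eta>) / ?f \<eta> else 0)"
    unfolding summand monom_degree_def
    by (simp flip: sum_distrib_left sum_divide_distrib of_nat_sum)
  finally show ?case
    by (simp add: algebra_simps)
qed

text \<open>Coefficientwise form of \<open>\<partial>_i l^(K+1) = (K+1) l^K\<close> for
  \<open>l = X_1 + ... + X_n\<close>.\<close>

lemma lookup_linear_power_Suc:
  "lookup ((\<Sum>i\<in>(UNIV::'n::finite set). mvar i) ^ Suc K) (single i 1 + \<eta>) * real (Suc (lookup \<eta> i)) =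
     real (Suc K) * lookup ((\<Sum>i\<in>UNIV. mvar i) ^ K) \<eta>"
proof -
  let ?f = "\<lambda>\<eta>::'n \<Rightarrow>\<^sub>0 nat. \<Prod>i\<in>UNIV. fact (lookup \<eta> i) :: real"
  let ?\<zeta> = "single i 1 + \<eta>"
  have "?f ?\<zeta> = fact (lookup ?\<zeta> i) * (\<Prod>j\<in>UNIV - {i}. fact (lookup ?\<zeta> j))"
    by (rule prod.remove) auto
  also have "\<dots> = real (Suc (lookup \<eta> i)) * (fact (lookup \<eta> i) * (\<Prod>j\<in>UNIV - {i}. fact (lookup \<eta> j)))"
    by (simp add: lookup_add lookup_single when_def mult.assoc)
  also have "fact (lookup \<eta> i) * (\<Prod>j\<in>UNIV - {i}. fact (lookup \<eta> j)) = ?f \<eta>"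
    by (rule prod.remove[symmetric]) auto
  finally have f: "?f ?\<zeta> = real (Suc (lookup \<eta> i)) * ?f \<eta>" .
  have "?f \<eta> \<noteq> 0" by simp
  then show ?thesis
    unfolding lookup_linear_power f monom_degree_add by simp
qed

subsection \<open>Gaussian moments\<close>

definition std_moment :: "nat \<Rightarrow> real" where
  "std_moment k = (LBINT x. std_normal_density x * x ^ k)"

lemma std_moment_0 [simp]: "std_moment 0 = 1"
  using integral_std_normal_moment_even[of 0] by (simp add: std_moment_def)

text \<open>Recursion of the double factorial \<open>(2N-1)!! = (2N)! / (2^N N!)\<close>, the moment
  of order \<open>2N\<close> of a standard normal variable.\<close>

lemma fact_quotient_Suc:
  "fact (2 * Suc N) / (2 ^ Suc N * fact (Suc N)) =
     real (Suc (2 * N)) * (fact (2 * N) / (2 ^ N * fact N))"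
proof -
  have num: "fact (2 * Suc N) = (2 * real (Suc N)) * (real (Suc (2 * N)) * fact (2 * N))"
    by (simp add: algebra_simps)
  have den: "2 ^ Suc N * fact (Suc N) = (2 * real (Suc N)) * (2 ^ N * fact N)"
    by (simp add: algebra_simps)
  have "2 * real (Suc N) \<noteq> 0" by simp
  then show ?thesis
    unfolding num den by (subst mult_divide_mult_cancel_left) simp_all
qed

text \<open>Integration by parts in one dimension, read off from the closed formulas: for even
  \<open>k\<close> both sides vanish, for odd \<open>k\<close> the double factorial recursion
  applies. At \<open>k = 0\<close> the truncated \<open>k - 1\<close> is harmless because of the
  factor \<open>k\<close>.\<close>

lemma std_moment_Suc: "std_moment (Suc k) = real k * std_moment (k - 1)"
proof (cases "even k")
  case True
  then obtain j where j: "k = 2 * j" by blast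
  show ?thesis
  proof (cases j)
    case 0
    then show ?thesis using integral_std_normal_moment_odd[of 0] j by (simp add: std_moment_def)
  next
    case (Suc l)
    then show ?thesis
      using integral_std_normal_moment_odd[of j] integral_std_normal_moment_odd[of l] j
      by (simp add: std_moment_def)
  qed
next
  case False
  then obtain j where j: "k = 2 * j + 1" by (auto elim: oddE)
  have m: "std_moment (2 * i) = fact (2 * i) / (2 ^ i * fact i)" for i
    unfolding std_moment_def by (rule integral_std_normal_moment_even)
  have "std_moment (2 * Suc j) = real (Suc (2 * j)) * std_moment (2 * j)"
    unfolding m by (rule fact_quotient_Suc)
  then show ?thesis
    by (simp add: j)
qed

text \<open>The expectation of \<open>y^\<alpha>\<close> for a standard Gaussian vector
  \<open>y\<close>; its coordinates are independent, whence the product.\<close>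

definition gauss_moment :: "('n::finite \<Rightarrow>\<^sub>0 nat) \<Rightarrow> real" where
  "gauss_moment \<alpha> = (\<Prod>i\<in>UNIV. std_moment (lookup \<alpha> i))"

lemma gauss_moment_0 [simp]: "gauss_moment 0 = 1"
  by (simp add: gauss_moment_def)

text \<open>Gaussian integration by parts, \<open>E (y\<^sub>i g) = E (\<partial>\<^sub>i g)\<close>, for a monomial \<open>g\<close>.\<close>

lemma gauss_moment_unit_add:
  "gauss_moment (single i 1 + \<zeta>) = real (lookup \<zeta> i) * gauss_moment (\<zeta> - single i 1)"
proof -
  have "gauss_moment (single i 1 + \<zeta>) =
      std_moment (Suc (lookup \<zeta> i)) * (\<Prod>j\<in>UNIV - {i}. std_moment (lookup (single i 1 + \<zeta>) j))"
    unfolding gauss_moment_def by (subst prod.remove[of _ i]) (auto simp: lookup_add)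
  also have "(\<Prod>j\<in>UNIV - {i}. std_moment (lookup (single i 1 + \<zeta>) j)) =
      (\<Prod>j\<in>UNIV - {i}. std_moment (lookup (\<zeta> - single i 1) j))"
    by (intro prod.cong) (auto simp: lookup_add lookup_minus lookup_single when_def)
  also have "std_moment (Suc (lookup \<zeta> i)) * \<dots> =
      real (lookup \<zeta> i) * (std_moment (lookup (\<zeta> - single i 1) i) * \<dots>)"
    by (simp add: std_moment_Suc lookup_minus)
  also have "std_moment (lookup (\<zeta> - single i 1) i) *
      (\<Prod>j\<in>UNIV - {i}. std_moment (lookup (\<zeta> - single i 1) j)) = gauss_moment (\<zeta> - single i 1)"
    unfolding gauss_moment_def by (rule prod.remove[symmetric]) auto
  finally show ?thesis .
qed

subsection \<open>Evaluation\<close>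

definition monom_value :: "real ^ 'n \<Rightarrow> ('n::finite \<Rightarrow>\<^sub>0 nat) \<Rightarrow> real" where
  "monom_value x \<alpha> = (\<Prod>i\<in>UNIV. (x $ i) ^ lookup \<alpha> i)"

lemma mpoly_eval_eq: "mpoly_eval p x = coeff_pairing (monom_value x) p"
  by (simp add: mpoly_eval_def coeff_pairing_def monom_value_def)

lemma monom_value_add: "monom_value x (\<alpha> + \<beta>) = monom_value x \<alpha> * monom_value x \<beta>"
  by (simp add: monom_value_def lookup_add power_add prod.distrib)

lemma monom_value_scale: "monom_value (c *\<^sub>R x) \<alpha> = c ^ monom_degree \<alpha> * monom_value x \<alpha>"
  by (simp add: monom_value_def monom_degree_def power_mult_distrib prod.distrib power_sum)

lemma mpoly_eval_sum: "mpoly_eval (sum f I) x = (\<Sum>i\<in>I. mpoly_eval (f i) x)"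
  by (simp add: mpoly_eval_eq coeff_pairing_sum)

lemma mpoly_eval_single: "mpoly_eval (single \<alpha> a) x = a * monom_value x \<alpha>"
  by (simp add: mpoly_eval_eq)

lemma mpoly_eval_times: "mpoly_eval (p * q) x = mpoly_eval p x * mpoly_eval q x"
proof -
  have "mpoly_eval (single \<alpha> a * q) x = a * monom_value x \<alpha> * mpoly_eval q x" for \<alpha> a
    by (simp add: mpoly_eval_eq coeff_pairing_single_times monom_value_add)
      (simp add: coeff_pairing_def sum_distrib_left algebra_simps)
  then have "mpoly_eval ((\<Sum>\<alpha>\<in>keys p. single \<alpha> (lookup p \<alpha>)) * q) x =
      (\<Sum>\<alpha>\<in>keys p. lookup p \<alpha> * monom_value x \<alpha>) * mpoly_eval q x"
    by (simp add: sum_distrib_right mpoly_eval_sum)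
  then show ?thesis
    by (simp add: sum_single_lookup mpoly_eval_eq coeff_pairing_def)
qed

lemma mpoly_eval_diff: "mpoly_eval (p - q) x = mpoly_eval p x - mpoly_eval q x"
  using coeff_pairing_add[of "monom_value x" "p - q" q] by (simp add: mpoly_eval_eq)

lemma mpoly_eval_scale:
  assumes "homogeneous d p"
  shows "mpoly_eval p (c *\<^sub>R x) = c ^ d * mpoly_eval p x"
proof -
  have "lookup p \<alpha> * monom_value (c *\<^sub>R x) \<alpha> = c ^ d * (lookup p \<alpha> * monom_value x \<alpha>)"
    if "\<alpha> \<in> keys p" for \<alpha>
    using assms that by (simp add: homogeneous_def in_keys_iff monom_value_scale)
  then show ?thesis
    unfolding mpoly_eval_eq coeff_pairing_def sum_distrib_left by (rule sum.cong[OF refl])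
qed

lemma continuous_on_mpoly_eval [continuous_intros]:
  "continuous_on S f \<Longrightarrow> continuous_on S (\<lambda>z. mpoly_eval p (f z))"
  unfolding mpoly_eval_def by (intro continuous_intros)

text \<open>The pairing is the integral of \<open>p\<close> against the standard Gaussian measure,
  realized as a product of normal laws.\<close>

lemma gauss_pairing_nonneg:
  assumes "\<And>y. 0 \<le> mpoly_eval p y"
  shows "0 \<le> coeff_pairing gauss_moment p"
proof -
  let ?\<nu> = "density lborel (\<lambda>x. ennreal (std_normal_density x))"
  let ?M = "Pi\<^sub>M (UNIV :: 'a set) (\<lambda>_. ?\<nu>)"
  interpret prob_space ?\<nu>
    by (rule prob_space_normal_density) simp
  interpret product_sigma_finite "\<lambda>_ :: 'a. ?\<nu>"
    by standard
  have moment: "(\<integral>x. x ^ k \<partial>?\<nu>) = std_moment k" and int: "integrable ?\<nu> (\<lambda>x. x ^ k)" for k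
    using integrable_std_normal_moment[of k]
    by (simp_all add: integral_density integrable_density std_moment_def normal_density_nonneg)
  \<comment> \<open>Independence: a monomial is integrated factor by factor. Integrability of each
    monomial allows \<open>p\<close> to be integrated term by term.\<close>
  have mono: "(\<integral>y. (\<Prod>i\<in>UNIV. y i ^ lookup \<alpha> i) \<partial>?M) = gauss_moment \<alpha>"
    "integrable ?M (\<lambda>y. \<Prod>i\<in>UNIV. y i ^ lookup \<alpha> i)" for \<alpha> :: "'a \<Rightarrow>\<^sub>0 nat"
    using product_integral_prod[of UNIV "\<lambda>i x. x ^ lookup \<alpha> i"]
      product_integrable_prod[of UNIV "\<lambda>i x. x ^ lookup \<alpha> i"] int
    by (simp_all add: moment gauss_moment_def)
  have "coeff_pairing gauss_moment p = (\<integral>y. mpoly_eval p (\<chi> i. y i) \<partial>?M)"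
    by (simp add: mpoly_eval_def coeff_pairing_def mono)
  also have "\<dots> \<ge> 0"
    using assms by (intro Bochner_Integration.integral_nonneg) auto
  finally show ?thesis .
qed

text \<open>The coefficient of \<open>x^\<eta>\<close> in \<open>y^\<alpha> (y . x)^K\<close> is
  that in \<open>(x_1 + ... + x_n)^K\<close> times \<open>y^(\<alpha>+\<eta>)\<close>. Expectation
  in \<open>y\<close> thus becomes a rescaling of coefficients by moments, without a second set of
  variables.\<close>

definition coeff_scale :: "('a \<Rightarrow> real) \<Rightarrow> ('a \<Rightarrow>\<^sub>0 real) \<Rightarrow> ('a \<Rightarrow>\<^sub>0 real)" where
  "coeff_scale c = Poly_Mapping.mapp (\<lambda>\<alpha> a. a * c \<alpha>)"

lemma lookup_coeff_scale [simp]: "lookup (coeff_scale c p) \<alpha> = lookup p \<alpha> * c \<alpha>"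
  by (simp add: coeff_scale_def lookup_mapp when_def in_keys_iff)

lemma coeff_scale_mvar_times:
  "coeff_scale c (mvar i * p) = mvar i * coeff_scale (\<lambda>\<eta>. c (single i 1 + \<eta>)) p"
proof (rule poly_mapping_eqI)
  fix \<eta>
  show "lookup (coeff_scale c (mvar i * p)) \<eta> =
      lookup (mvar i * coeff_scale (\<lambda>\<eta>. c (single i 1 + \<eta>)) p) \<eta>"
    using unit_exponent_split[of \<eta> i] by (simp add: lookup_mvar_times)
qed

lemma coeff_scale_sum: "coeff_scale c (sum f I) = (\<Sum>i\<in>I. coeff_scale c (f i))"
  by (rule poly_mapping_eqI) (simp add: lookup_sum sum_distrib_right)

subsection \<open>The Gaussian transform\<close>

text \<open>The polynomial \<open>x \<mapsto> E (y\<^sup>\<alpha> (y \<bullet> x)\<^sup>K)\<close> for a standard Gaussian vector \<open>y\<close>.\<close>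

definition gauss_power :: "('n::finite \<Rightarrow>\<^sub>0 nat) \<Rightarrow> nat \<Rightarrow> 'n mpoly" where
  "gauss_power \<alpha> K = coeff_scale (\<lambda>\<eta>. gauss_moment (\<alpha> + \<eta>)) ((\<Sum>i\<in>UNIV. mvar i) ^ K)"

text \<open>One factor \<open>y . x\<close> is expanded, and each \<open>y_i\<close> is absorbed
  into \<open>y^\<alpha>\<close>.\<close>

lemma gauss_power_Suc: "gauss_power \<alpha> (Suc K) = (\<Sum>i\<in>UNIV. mvar i * gauss_power (single i 1 + \<alpha>) K)"
  unfolding gauss_power_def power_Suc sum_distrib_right coeff_scale_sum coeff_scale_mvar_times
  by (simp add: algebra_simps)

text \<open>Gaussian integration by parts in \<open>y_i\<close>: the product rule for
  \<open>y^\<alpha> (y . x)^(K+1)\<close> gives one term from the power and one from the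
  monomial.\<close>

lemma gauss_power_unit_add:
  "gauss_power (single i 1 + \<alpha>) (Suc K) =
     single 0 (real (Suc K)) * (mvar i * gauss_power \<alpha> K) +
     single 0 (real (lookup \<alpha> i)) * gauss_power (\<alpha> - single i 1) (Suc K)"
proof (rule poly_mapping_eqI)
  fix \<eta> :: "'a \<Rightarrow>\<^sub>0 nat"
  let ?l = "\<Sum>j\<in>(UNIV :: 'a set). mvar j"
  \<comment> \<open>The factor \<open>\<alpha>_i + \<eta>_i\<close> of
    \<open>gauss_moment_unit_add\<close> is split: the share \<open>\<eta>_i\<close> is the
    derivative of the power, the share \<open>\<alpha>_i\<close> that of the monomial.\<close>
  have 1: "lookup (single 0 (real (Suc K)) * (mvar i * gauss_power \<alpha> K)) \<eta> =
      lookup (?l ^ Suc K) \<eta> * (real (lookup \<eta> i) * gauss_moment (\<alpha> + \<eta> - single i 1))"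
  proof (cases "lookup \<eta> i = 0")
    case True
    then show ?thesis by (simp add: lookup_mvar_times del: power_Suc)
  next
    case False
    define \<zeta> where "\<zeta> = \<eta> - single i 1"
    have \<eta>: "\<eta> = single i 1 + \<zeta>"
      using unit_exponent_split[OF False] by (simp add: \<zeta>_def)
    have "\<alpha> + \<eta> - single i 1 = \<alpha> + \<zeta>"
      unfolding \<eta> by (metis add.left_commute add_diff_cancel_left')
    moreover have "lookup (?l ^ Suc K) \<eta> * real (lookup \<eta> i) = real (Suc K) * lookup (?l ^ K) \<zeta>"
      using lookup_linear_power_Suc[of K i \<zeta>] by (simp add: \<eta> lookup_add del: power_Suc)
    moreover have "lookup (single 0 (real (Suc K)) * (mvar i * gauss_power \<alpha> K)) \<eta> =
        real (Suc K) * lookup (?l ^ K) \<zeta> * gauss_moment (\<alpha> + \<zeta>)"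
      using False by (simp add: lookup_mvar_times gauss_power_def \<zeta>_def)
    ultimately show ?thesis
      by (simp add: mult.assoc[symmetric] del: power_Suc of_nat_Suc)
  qed
  have 2: "lookup (single 0 (real (lookup \<alpha> i)) * gauss_power (\<alpha> - single i 1) (Suc K)) \<eta> =
      lookup (?l ^ Suc K) \<eta> * (real (lookup \<alpha> i) * gauss_moment (\<alpha> + \<eta> - single i 1))"
  proof (cases "lookup \<alpha> i = 0")
    case False
    then have "\<alpha> + \<eta> - single i 1 = \<alpha> - single i 1 + \<eta>"
      by (intro poly_mapping_eqI) (auto simp: lookup_add lookup_minus lookup_single when_def)
    then show ?thesis
      by (simp add: gauss_power_def del: power_Suc single_of_nat)
  qed simp
  show "lookup (gauss_power (single i 1 + \<alpha>) (Suc K)) \<eta> = lookup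
     (single 0 (real (Suc K)) * (mvar i * gauss_power \<alpha> K) +
      single 0 (real (lookup \<alpha> i)) * gauss_power (\<alpha> - single i 1) (Suc K)) \<eta>"
    unfolding lookup_add 1 2 using gauss_moment_unit_add[of i "\<alpha> + \<eta>"]
    by (simp add: gauss_power_def add.assoc lookup_add algebra_simps del: power_Suc)
qed

lemma gauss_power_0_Suc_Suc:
  "gauss_power 0 (Suc (Suc K)) = single 0 (real (Suc K)) * (norm_square * gauss_power 0 K)"
proof -
  have "gauss_power 0 (Suc (Suc K)) =
      (\<Sum>i\<in>UNIV. mvar i * gauss_power (single i 1 + 0) (Suc K))"
    by (rule gauss_power_Suc)
  also have "\<dots> = (\<Sum>i\<in>UNIV. mvar i * (single 0 (real (Suc K)) * (mvar i * gauss_power 0 K)))"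
    unfolding gauss_power_unit_add by simp
  finally show ?thesis
    by (simp add: norm_square_times sum_distrib_left mult.left_commute)
qed

text \<open>\<open>y . x\<close> is a centred Gaussian of variance \<open>|x|^2\<close>, so its
  moment of order \<open>2N\<close> is \<open>(2N-1)!! |x|^(2N)\<close>.\<close>

lemma gauss_power_0_even:
  "gauss_power 0 (2 * N) = single 0 (fact (2 * N) / (2 ^ N * fact N)) * norm_square ^ N"
proof (induction N)
  case 0
  show ?case
    by (rule poly_mapping_eqI) (auto simp: gauss_power_def lookup_one when_def)
next
  case (Suc N)
  have "real (Suc (2 * N)) * (fact (2 * N) / (2 ^ N * fact N)) =
      fact (2 * Suc N) / (2 ^ Suc N * fact (Suc N))"
    by (rule fact_quotient_Suc[symmetric])
  then have "single 0 (fact (2 * Suc N) / (2 ^ Suc N * fact (Suc N))) =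
      single (0 :: 'a \<Rightarrow>\<^sub>0 nat) (real (Suc (2 * N))) * single 0 (fact (2 * N) / (2 ^ N * fact N))"
    by (simp only: mult_single) simp
  moreover have "2 * Suc N = Suc (Suc (2 * N))" by simp
  ultimately show ?case
    using Suc.IH by (simp only: gauss_power_0_Suc_Suc) (simp add: mult_ac)
qed

section \<open>Leading asymptotics of the transform\<close>

lemma tendsto_lookup_mvar_times:
  assumes "\<And>\<eta>. (\<lambda>N. lookup (T N) \<eta>) \<longlonglongrightarrow> l \<eta>"
  shows "(\<lambda>N. lookup (mvar i * T N) \<eta>) \<longlonglongrightarrow> (if lookup \<eta> i = 0 then 0 else l (\<eta> - single i 1))"
  unfolding lookup_mvar_times using assms by auto

text \<open>Each coefficient of the product is a finite sum of coefficients of \<open>T N\<close>.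
  The limit is left open because \<open>gauss_power_asymptotics\<close> multiplies it by a null
  sequence.\<close>

lemma convergent_lookup_norm_square_times:
  assumes "\<And>\<eta>. convergent (\<lambda>N. lookup (T N) \<eta>)"
  shows "convergent (\<lambda>N. lookup (norm_square * T N) \<eta>)"
proof -
  have mvar: "convergent (\<lambda>N. lookup (mvar i * S N) \<eta>)"
    if "\<And>\<eta>. convergent (\<lambda>N. lookup (S N) \<eta>)" for S i \<eta>
    using that by (cases "lookup \<eta> i = 0") (simp_all add: lookup_mvar_times convergent_const)
  show ?thesis
    unfolding norm_square_times lookup_sum by (intro convergent_sum mvar assms)
qed

text \<open>Induction on the degree by integration by parts, with
  \<open>\<alpha> = single i 1 + \<beta>\<close>. The derivative of the power leads to
  \<open>X_i\<close> times the forms for \<open>\<beta>\<close>, which tend to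
  \<open>X^\<alpha>\<close>; the derivative of the monomial leads to an exponent of degree two less
  and vanishes in the limit.\<close>

lemma gauss_power_asymptotics:
  "\<exists>T. (\<forall>N. homogeneous (monom_degree \<alpha>) (T N)) \<and>
     (\<forall>\<eta>. (\<lambda>N. lookup (T N) \<eta>) \<longlonglongrightarrow> lookup (single \<alpha> 1) \<eta>) \<and>
     (\<forall>N. gauss_power \<alpha> (2 * N + monom_degree \<alpha>) =
       single 0 (fact (2 * N + monom_degree \<alpha>) / (2 ^ N * fact N)) * (norm_square ^ N * T N))"
proof (induction "monom_degree \<alpha>" arbitrary: \<alpha> rule: less_induct)
  case (less \<alpha>)
  show ?case
  proof (cases "\<alpha> = 0")
    case True
    have "homogeneous 0 (single (0 :: 'a \<Rightarrow>\<^sub>0 nat) 1)"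
      by (rule homogeneous_single) simp
    then show ?thesis
      using True by (intro exI[of _ "\<lambda>_. single 0 1"]) (simp add: gauss_power_0_even)
  next
    case False
    then obtain i where i: "lookup \<alpha> i \<noteq> 0"
      by (metis lookup_zero poly_mapping_eqI)
    define \<beta> where "\<beta> = \<alpha> - single i 1"
    have \<alpha>: "\<alpha> = single i 1 + \<beta>"
      unfolding \<beta>_def using unit_exponent_split[OF i] by simp
    then have deg: "monom_degree \<alpha> = Suc (monom_degree \<beta>)"
      by (simp add: monom_degree_add)
    define c :: "nat \<Rightarrow> real" where "c N = fact (2 * N + monom_degree \<alpha>) / (2 ^ N * fact N)" for N
    obtain T where T: "\<And>N. homogeneous (monom_degree \<beta>) (T N)"
      "\<And>\<eta>. (\<lambda>N. lookup (T N) \<eta>) \<longlonglongrightarrow> lookup (single \<beta> 1) \<eta>"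
      "\<And>N. gauss_power \<beta> (2 * N + monom_degree \<beta>) =
       single 0 (fact (2 * N + monom_degree \<beta>) / (2 ^ N * fact N)) * (norm_square ^ N * T N)"
      using less[of \<beta>] deg by auto
    \<comment> \<open>\<open>S\<close> is the contribution of the derivative of
      \<open>y^\<beta>\<close>; it is 0 if \<open>y_i\<close> does not occur there.\<close>
    obtain S where S: "\<And>N. homogeneous (monom_degree \<alpha>) (S N)"
      "\<And>\<eta>. (\<lambda>N. lookup (S N) \<eta>) \<longlonglongrightarrow> 0"
      "\<And>N. single 0 (real (lookup \<beta> i)) * gauss_power (\<beta> - single i 1) (2 * N + monom_degree \<alpha>) =
         single 0 (c N) * (norm_square ^ N * S N)"
    proof (cases "lookup \<beta> i = 0")
      case True
      then show ?thesis by (intro that[of "\<lambda>_. 0"]) (auto simp: homogeneous_zero)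
    next
      case False
      define \<gamma> where "\<gamma> = \<beta> - single i 1"
      have \<beta>: "\<beta> = single i 1 + \<gamma>"
        unfolding \<gamma>_def using unit_exponent_split[OF False] by simp
      then have deg': "monom_degree \<alpha> = Suc (Suc (monom_degree \<gamma>))"
        using deg by (simp add: monom_degree_add)
      obtain U where U: "\<And>N. homogeneous (monom_degree \<gamma>) (U N)"
        "\<And>\<eta>. (\<lambda>N. lookup (U N) \<eta>) \<longlonglongrightarrow> lookup (single \<gamma> 1) \<eta>"
        "\<And>N. gauss_power \<gamma> (2 * N + monom_degree \<gamma>) =
         single 0 (fact (2 * N + monom_degree \<gamma>) / (2 ^ N * fact N)) * (norm_square ^ N * U N)"
        using less[of \<gamma>] deg' by auto
      define b where "b = real (lookup \<beta> i)"
      show ?thesis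
      \<comment> \<open>As \<open>\<alpha>\<close> has degree two more than \<open>\<gamma>\<close>,
        the hypothesis for \<open>\<gamma>\<close> is used at \<open>N + 1\<close>. This leaves a
        spare factor \<open>norm_square\<close>, and passing from \<open>2^(N+1) (N+1)!\<close> to
        \<open>2^N N!\<close> costs the factor \<open>1 / (2 (N+1))\<close>, which tends to
        0.\<close>
      proof (rule that[of "\<lambda>N. single 0 (b / (2 * real (Suc N))) * (norm_square * U (Suc N))"])
        fix N
        show "homogeneous (monom_degree \<alpha>)
            (single 0 (b / (2 * real (Suc N))) * (norm_square * U (Suc N)))"
          unfolding deg' by (intro homogeneous_const_times homogeneous_norm_square_times U)
        have "2 * N + monom_degree \<alpha> = 2 * Suc N + monom_degree \<gamma>"
          by (simp add: deg')
        then have "single 0 b * gauss_power \<gamma> (2 * N + monom_degree \<alpha>) =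
            (single 0 b * single 0 (fact (2 * N + monom_degree \<alpha>) / (2 ^ Suc N * fact (Suc N)))) *
            (norm_square ^ Suc N * U (Suc N))"
          using U(3)[of "Suc N"] by (simp only: mult.assoc)
        also have "single 0 b * single 0 (fact (2 * N + monom_degree \<alpha>) / (2 ^ Suc N * fact (Suc N))) =
            single 0 (c N) * single (0 :: 'a \<Rightarrow>\<^sub>0 nat) (b / (2 * real (Suc N)))"
          by (simp add: mult_single c_def algebra_simps)
        finally show "single 0 (real (lookup \<beta> i)) *
            gauss_power (\<beta> - single i 1) (2 * N + monom_degree \<alpha>) =
            single 0 (c N) * (norm_square ^ N *
              (single 0 (b / (2 * real (Suc N))) * (norm_square * U (Suc N))))"
          by (simp add: b_def \<gamma>_def mult_ac)
      next
        fix \<eta>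
        have "convergent (\<lambda>N. lookup (norm_square * U N) \<eta>)"
          by (intro convergent_lookup_norm_square_times) (use U(2) in \<open>auto simp: convergent_def\<close>)
        then obtain l where "(\<lambda>N. lookup (norm_square * U N) \<eta>) \<longlonglongrightarrow> l"
          by (auto simp: convergent_def)
        then have l: "(\<lambda>N. lookup (norm_square * U (Suc N)) \<eta>) \<longlonglongrightarrow> l"
          by (rule LIMSEQ_Suc)
        have "(\<lambda>N. b / 2 * inverse (real (Suc N))) \<longlonglongrightarrow> b / 2 * 0"
          by (intro tendsto_intros LIMSEQ_inverse_real_of_nat)
        from tendsto_mult[OF this l]
        show "(\<lambda>N. lookup (single 0 (b / (2 * real (Suc N))) * (norm_square * U (Suc N))) \<eta>) \<longlonglongrightarrow> 0"
          by (simp add: divide_simps)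
      qed
    qed
    show ?thesis
    proof (intro exI[of _ "\<lambda>N. mvar i * T N + S N"] conjI allI)
      fix N
      show "homogeneous (monom_degree \<alpha>) (mvar i * T N + S N)"
        using homogeneous_mvar_times[OF T(1)] S(1) by (simp add: deg homogeneous_add)
      have e: "2 * N + monom_degree \<alpha> = Suc (2 * N + monom_degree \<beta>)"
        by (simp add: deg)
      have "gauss_power \<alpha> (2 * N + monom_degree \<alpha>) =
        single 0 (real (Suc (2 * N + monom_degree \<beta>))) * (mvar i * gauss_power \<beta> (2 * N + monom_degree \<beta>)) +
        single 0 (real (lookup \<beta> i)) * gauss_power (\<beta> - single i 1) (2 * N + monom_degree \<alpha>)"
        unfolding e unfolding \<alpha> by (rule gauss_power_unit_add)
      also have "\<dots> = (single 0 (real (Suc (2 * N + monom_degree \<beta>))) *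
            single 0 (fact (2 * N + monom_degree \<beta>) / (2 ^ N * fact N))) * (norm_square ^ N * (mvar i * T N)) +
          single 0 (c N) * (norm_square ^ N * S N)"
        unfolding S(3) T(3) by (simp only: mult_ac)
      also have "single 0 (real (Suc (2 * N + monom_degree \<beta>))) *
            single 0 (fact (2 * N + monom_degree \<beta>) / (2 ^ N * fact N)) = single (0 :: 'a \<Rightarrow>\<^sub>0 nat) (c N)"
        by (simp add: mult_single c_def e)
      finally show "gauss_power \<alpha> (2 * N + monom_degree \<alpha>) =
          single 0 (fact (2 * N + monom_degree \<alpha>) / (2 ^ N * fact N)) *
          (norm_square ^ N * (mvar i * T N + S N))"
        by (simp add: c_def algebra_simps)
    next
      fix \<eta>
      have "(if lookup \<eta> i = 0 then 0 else lookup (single \<beta> 1) (\<eta> - single i 1)) =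
          lookup (mvar i * single \<beta> 1) \<eta>"
        by (simp add: lookup_mvar_times)
      also have "mvar i * single \<beta> 1 = single \<alpha> 1"
        by (simp add: mvar_def mult_single \<alpha>)
      finally have "(\<lambda>N. lookup (mvar i * T N) \<eta>) \<longlonglongrightarrow> lookup (single \<alpha> 1) \<eta>"
        using tendsto_lookup_mvar_times[OF T(2), of i \<eta>] by simp
      from tendsto_add[OF this S(2)[of \<eta>]]
      show "(\<lambda>N. lookup (mvar i * T N + S N) \<eta>) \<longlonglongrightarrow> lookup (single \<alpha> 1) \<eta>"
        by (simp add: lookup_add)
    qed
  qed
qed

text \<open>The polynomial \<open>x \<mapsto> E (p(y) (y \<bullet> x)\<^sup>K)\<close> for a standard Gaussian vector \<open>y\<close>.\<close>

definition gauss_transform :: "nat \<Rightarrow> 'n::finite mpoly \<Rightarrow> 'n mpoly" where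
  "gauss_transform K p =
     coeff_scale (\<lambda>\<eta>. coeff_pairing (\<lambda>\<alpha>. gauss_moment (\<alpha> + \<eta>)) p) ((\<Sum>i\<in>UNIV. mvar i) ^ K)"

lemma gauss_transform_eq_sum:
  "gauss_transform K p = (\<Sum>\<alpha>\<in>keys p. single 0 (lookup p \<alpha>) * gauss_power \<alpha> K)"
  by (rule poly_mapping_eqI)
    (simp add: gauss_transform_def gauss_power_def coeff_pairing_def lookup_sum sum_distrib_left mult_ac)

text \<open>Linear combination of the monomial case: the monomials of a form have equal degree, so
  they share the constant and the power of \<open>norm_square\<close>.\<close>

lemma gauss_transform_asymptotics:
  fixes p :: "'n::finite mpoly"
  assumes "homogeneous d p"
  shows "\<exists>T. (\<forall>N. homogeneous d (T N)) \<and> (\<forall>\<eta>. (\<lambda>N. lookup (T N) \<eta>) \<longlonglongrightarrow> lookup p \<eta>) \<and>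
     (\<forall>N. gauss_transform (2 * N + d) p =
       single 0 (fact (2 * N + d) / (2 ^ N * fact N)) * (norm_square ^ N * T N))"
proof -
  have deg: "monom_degree \<alpha> = d" if "\<alpha> \<in> keys p" for \<alpha>
    using assms that by (simp add: homogeneous_def in_keys_iff)
  obtain T :: "('n \<Rightarrow>\<^sub>0 nat) \<Rightarrow> nat \<Rightarrow> 'n mpoly"
    where T: "\<And>\<alpha> N. homogeneous (monom_degree \<alpha>) (T \<alpha> N)"
     "\<And>\<alpha> \<eta>. (\<lambda>N. lookup (T \<alpha> N) \<eta>) \<longlonglongrightarrow> lookup (single \<alpha> 1) \<eta>"
     "\<And>\<alpha> N. gauss_power \<alpha> (2 * N + monom_degree \<alpha>) =
       single 0 (fact (2 * N + monom_degree \<alpha>) / (2 ^ N * fact N)) * (norm_square ^ N * T \<alpha> N)"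
    using gauss_power_asymptotics by metis
  show ?thesis
  proof (intro exI[of _ "\<lambda>N. \<Sum>\<alpha>\<in>keys p. single 0 (lookup p \<alpha>) * T \<alpha> N"] conjI allI)
    fix N
    show "homogeneous d (\<Sum>\<alpha>\<in>keys p. single 0 (lookup p \<alpha>) * T \<alpha> N)"
      using T(1) deg by (intro homogeneous_sum homogeneous_const_times) metis
    have "single 0 (lookup p \<alpha>) * gauss_power \<alpha> (2 * N + d) =
        single 0 (fact (2 * N + d) / (2 ^ N * fact N)) *
          (norm_square ^ N * (single 0 (lookup p \<alpha>) * T \<alpha> N))" if "\<alpha> \<in> keys p" for \<alpha>
      using T(3)[where \<alpha> = \<alpha>] deg[OF that] by (simp add: mult_ac)
    then show "gauss_transform (2 * N + d) p = single 0 (fact (2 * N + d) / (2 ^ N * fact N)) *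
        (norm_square ^ N * (\<Sum>\<alpha>\<in>keys p. single 0 (lookup p \<alpha>) * T \<alpha> N))"
      unfolding gauss_transform_eq_sum sum_distrib_left by (rule sum.cong[OF refl])
  next
    fix \<eta>
    have "(\<lambda>N. \<Sum>\<alpha>\<in>keys p. lookup p \<alpha> * lookup (T \<alpha> N) \<eta>)
        \<longlonglongrightarrow> (\<Sum>\<alpha>\<in>keys p. lookup p \<alpha> * lookup (single \<alpha> 1) \<eta>)"
      by (intro tendsto_intros T)
    also have "(\<Sum>\<alpha>\<in>keys p. lookup p \<alpha> * lookup (single \<alpha> 1) \<eta>) =
        lookup (\<Sum>\<alpha>\<in>keys p. single \<alpha> (lookup p \<alpha>)) \<eta>"
      by (simp add: lookup_sum lookup_single when_def if_distrib cong: if_cong)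
    finally show "(\<lambda>N. lookup (\<Sum>\<alpha>\<in>keys p. single 0 (lookup p \<alpha>) * T \<alpha> N) \<eta>) \<longlonglongrightarrow> lookup p \<eta>"
      by (simp add: lookup_sum sum_single_lookup)
  qed
qed

subsection \<open>Sums of squares of polynomial matrices\<close>

text \<open>Each \<open>q\<close> is a vector contributing the rank-one matrix \<open>q q^T\<close>.
  With a list of summands, adding two sums of squares is concatenation.\<close>

definition sos_entries :: "('t \<Rightarrow> 't \<Rightarrow> 'a::comm_semiring_1) \<Rightarrow> bool" where
  "sos_entries P \<longleftrightarrow> (\<exists>qs. \<forall>s t. P s t = (\<Sum>q\<leftarrow>qs. q s * q t))"

lemma sos_entries_zero: "sos_entries (\<lambda>s t. 0)"
  unfolding sos_entries_def by (rule exI[of _ "[]"]) simp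

lemma sos_entries_add:
  assumes "sos_entries P" "sos_entries Q"
  shows "sos_entries (\<lambda>s t. P s t + Q s t)"
proof -
  from assms obtain ps qs where "\<forall>s t. P s t = (\<Sum>q\<leftarrow>ps. q s * q t)" "\<forall>s t. Q s t = (\<Sum>q\<leftarrow>qs. q s * q t)"
    unfolding sos_entries_def by blast
  then show ?thesis
    unfolding sos_entries_def by (intro exI[of _ "ps @ qs"]) simp
qed

lemma sos_entries_sum:
  "(\<And>i. i \<in> I \<Longrightarrow> sos_entries (P i)) \<Longrightarrow> sos_entries (\<lambda>s t. \<Sum>i\<in>I. P i s t)"
  by (induction I rule: infinite_finite_induct) (simp_all add: sos_entries_zero sos_entries_add)

lemma sos_entries_square_times:
  assumes "sos_entries P"
  shows "sos_entries (\<lambda>s t. r * (r * P s t))"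
proof -
  from assms obtain qs where "\<forall>s t. P s t = (\<Sum>q\<leftarrow>qs. q s * q t)"
    unfolding sos_entries_def by blast
  then show ?thesis
    unfolding sos_entries_def
    by (intro exI[of _ "map (\<lambda>q s. r * q s) qs"])
      (simp add: o_def sum_list_const_mult[symmetric] mult_ac)
qed

lemma sos_entries_norm_square_power_times:
  assumes "sos_entries P"
  shows "sos_entries (\<lambda>s t. norm_square ^ N * P s t)"
proof (induction N)
  case (Suc N)
  have "sos_entries (\<lambda>s t. norm_square * (norm_square ^ N * P s t))"
    unfolding norm_square_times by (intro sos_entries_sum sos_entries_square_times Suc.IH)
  then show ?case by (simp add: mult.assoc)
qed (simp add: assms)

lemma sos_entries_const_times:
  fixes P :: "'t \<Rightarrow> 't \<Rightarrow> 'n mpoly"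
  assumes "sos_entries P" "a \<ge> 0"
  shows "sos_entries (\<lambda>s t. single (0 :: 'n \<Rightarrow>\<^sub>0 nat) a * P s t)"
proof -
  have "single (0 :: 'n \<Rightarrow>\<^sub>0 nat) a = single 0 (sqrt a) * single 0 (sqrt a)"
    using assms(2) by (simp add: mult_single)
  then show ?thesis
    using sos_entries_square_times[OF assms(1), of "single 0 (sqrt a)"] by (simp only: mult.assoc)
qed

text \<open>A product \<open>q s * q t\<close> is an entry of \<open>A\<^sup>T A\<close> for a matrix \<open>A\<close> with a single nonzero row \<open>q\<close>.\<close>

lemma sos_pmats_if_sos_entries:
  fixes F :: "('n, 't::finite) pmat"
  assumes "sos_entries (\<lambda>s t. F $ s $ t)"
  shows "F \<in> sos_pmats"
proof -
  obtain qs where qs: "\<And>s t. F $ s $ t = (\<Sum>q\<leftarrow>qs. q s * q t)"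
    using assms unfolding sos_entries_def by blast
  define r :: 't where "r = undefined"
  define A :: "nat \<Rightarrow> ('n, 't) pmat" where "A k = (\<chi> i j. if i = r then (qs ! k) j else 0)" for k
  have "(transpose (A k) ** A k) $ s $ t = (qs ! k) s * (qs ! k) t" for k s t
    by (simp add: matrix_matrix_mult_def transpose_def A_def if_distrib if_distribR cong: if_cong)
  then have "F = (\<Sum>k<length qs. transpose (A k) ** A k)"
    by (simp add: vec_eq_iff qs sum_list_sum_nth atLeast0LessThan)
  then show ?thesis
    unfolding sos_pmats_def by blast
qed

subsection \<open>Gram matrices\<close>

text \<open>Symmetric Gaussian elimination: the index \<open>p\<close> with pivot
  \<open>g = G p p\<close> splits off the rank-one matrix \<open>G p i * G p j / g\<close>, and the
  Schur complement on \<open>I\<close> is again positive semidefinite.\<close>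

lemma psd_sum_of_rank_one:
  fixes G :: "'i \<Rightarrow> 'i \<Rightarrow> real"
  assumes "finite I" "\<And>i j. G i j = G j i"
    and "\<And>v. 0 \<le> (\<Sum>i\<in>I. \<Sum>j\<in>I. v i * v j * G i j)"
  shows "\<exists>as. \<forall>i\<in>I. \<forall>j\<in>I. G i j = (\<Sum>a\<leftarrow>as. a i * a j)"
  using assms
proof (induction I arbitrary: G rule: finite_induct)
  case empty
  then show ?case by auto
next
  case (insert p I)
  note sym = insert.prems(1) and psd = insert.prems(2)
  define g where "g = G p p"
  have expand: "(\<Sum>i\<in>insert p I. \<Sum>j\<in>insert p I. v i * v j * G i j) =
      (v p)\<^sup>2 * g + 2 * v p * (\<Sum>i\<in>I. v i * G p i) + (\<Sum>i\<in>I. \<Sum>j\<in>I. v i * v j * G i j)" for v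
  proof -
    have "(\<Sum>i\<in>I. v i * v p * G i p) = v p * (\<Sum>i\<in>I. v i * G p i)"
      unfolding sum_distrib_left by (intro sum.cong) (simp_all add: sym[of _ p])
    moreover have "(\<Sum>i\<in>I. v p * v i * G p i) = v p * (\<Sum>i\<in>I. v i * G p i)"
      by (simp add: sum_distrib_left mult.assoc)
    ultimately show ?thesis
      using insert.hyps by (simp add: sum.distrib g_def power2_eq_square)
  qed
  have g: "g \<ge> 0"
  proof -
    let ?v = "\<lambda>i. if i = p then 1 else 0"
    have "(\<Sum>i\<in>I. ?v i * G p i) = 0" "(\<Sum>i\<in>I. \<Sum>j\<in>I. ?v i * ?v j * G i j) = 0"
      using insert.hyps by (auto intro!: sum.neutral)
    then show ?thesis
      using psd[of ?v] unfolding expand by simp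
  qed
  \<comment> \<open>A zero pivot of a positive semidefinite matrix has a zero row, so nothing is
    split off in that case.\<close>
  have row0: "G p j = 0" if "g = 0" "j \<in> I" for j
  proof (rule ccontr)
    assume "G p j \<noteq> 0"
    \<comment> \<open>For \<open>g = 0\<close> the vector with entries \<open>c\<close> at
      \<open>p\<close> and 1 at \<open>j\<close> has form value
      \<open>2 * c * G p j + G j j\<close>; this \<open>c\<close> makes it -1.\<close>
    define c where "c = - (G j j + 1) / (2 * G p j)"
    let ?v = "\<lambda>i. if i = p then c else if i = j then 1 else 0"
    have v: "?v i = (if i = j then 1 else 0)" if "i \<in> I" for i
      using that insert.hyps by auto
    have "(\<Sum>i\<in>I. ?v i * G p i) = (\<Sum>i\<in>I. if i = j then G p i else 0)"
      by (intro sum.cong) (auto simp: v)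
    then have 1: "(\<Sum>i\<in>I. ?v i * G p i) = G p j"
      using insert.hyps that by simp
    have "(\<Sum>i\<in>I. \<Sum>k\<in>I. ?v i * ?v k * G i k) =
        (\<Sum>i\<in>I. if i = j then (\<Sum>k\<in>I. if k = j then G i k else 0) else 0)"
      by (intro sum.cong) (auto simp: v intro!: sum.cong)
    then have 2: "(\<Sum>i\<in>I. \<Sum>k\<in>I. ?v i * ?v k * G i k) = G j j"
      using insert.hyps that by simp
    have "0 \<le> 2 * c * G p j + G j j"
      using psd[of ?v] unfolding expand 1 2 using \<open>g = 0\<close> by simp
    moreover have "2 * c * G p j = - (G j j + 1)"
      using \<open>G p j \<noteq> 0\<close> by (simp add: c_def)
    ultimately show False by linarith
  qed
  \<comment> \<open>The Schur complement; if \<open>g = 0\<close>, division by zero yields 0 and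
    \<open>H\<close> agrees with \<open>G\<close>.\<close>
  define H where "H i j = G i j - G p i * G p j / g" for i j
  have "0 \<le> (\<Sum>i\<in>I. \<Sum>j\<in>I. v i * v j * H i j)" for v
  proof -
    define b where "b = (\<Sum>i\<in>I. v i * G p i)"
    \<comment> \<open>For \<open>g > 0\<close> this entry at \<open>p\<close> minimizes the form of
      \<open>G\<close> with the other entries fixed; the minimum is the form of
      \<open>H\<close>.\<close>
    let ?v = "\<lambda>i. if i = p then - (b / g) else v i"
    have v: "?v i = v i" if "i \<in> I" for i
      using that insert.hyps by auto
    have "(\<Sum>i\<in>I. ?v i * G p i) = (\<Sum>i\<in>I. v i * G p i)"
      by (intro sum.cong refl) (simp only: v)
    then have 1: "(\<Sum>i\<in>I. ?v i * G p i) = b"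
      by (simp only: b_def)
    have 2: "(\<Sum>i\<in>I. \<Sum>j\<in>I. ?v i * ?v j * G i j) = (\<Sum>i\<in>I. \<Sum>j\<in>I. v i * v j * G i j)"
      by (intro sum.cong refl) (simp only: v)
    have "(\<Sum>i\<in>I. \<Sum>j\<in>I. v i * v j * H i j) =
        (\<Sum>i\<in>I. \<Sum>j\<in>I. v i * v j * G i j) - (\<Sum>i\<in>I. \<Sum>j\<in>I. (v i * G p i) * (v j * G p j) / g)"
      by (simp add: H_def sum_subtractf[symmetric] algebra_simps)
    also have "(\<Sum>i\<in>I. \<Sum>j\<in>I. (v i * G p i) * (v j * G p j) / g) = b * b / g"
      unfolding b_def sum_product by (simp add: sum_divide_distrib)
    also have "(\<Sum>i\<in>I. \<Sum>j\<in>I. v i * v j * G i j) - b * b / g =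
        (\<Sum>i\<in>insert p I. \<Sum>j\<in>insert p I. ?v i * ?v j * G i j)"
      unfolding expand 1 2 by (cases "g = 0") (simp_all add: field_simps power2_eq_square)
    finally show ?thesis
      using psd[of ?v] by simp
  qed
  moreover have "H i j = H j i" for i j
    by (simp add: H_def sym[of i j] mult.commute)
  ultimately obtain as where as: "\<And>i j. i \<in> I \<Longrightarrow> j \<in> I \<Longrightarrow> H i j = (\<Sum>a\<leftarrow>as. a i * a j)"
    using insert.IH[of H] by blast
  \<comment> \<open>The vectors from the induction hypothesis are arbitrary at \<open>p\<close>, so
    they are reset to 0 there. For \<open>g = 0\<close> the first vector is 0 by division by
    zero.\<close>
  let ?as = "(\<lambda>i. G p i / sqrt g) # map (\<lambda>a. a(p := 0)) as"
  have "G i j = (\<Sum>a\<leftarrow>?as. a i * a j)" if ij: "i \<in> insert p I" "j \<in> insert p I" for i j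
  proof -
    have 0: "G p i / sqrt g * (G p j / sqrt g) = G p i * G p j / g"
      using g by (simp add: power2_eq_square[symmetric])
    show ?thesis
    proof (cases "i = p \<or> j = p")
      case True
      then have "G p i * G p j / g = G i j"
        using row0 ij sym[of i p] by (cases "g = 0") (auto simp: g_def)
      moreover have "(\<Sum>a\<leftarrow>as. (a(p := 0)) i * (a(p := 0)) j) = 0"
        using True by (auto simp: sum_list_0)
      ultimately show ?thesis
        unfolding list.map sum_list.Cons map_map o_def 0 by simp
    next
      case False
      then have "(\<Sum>a\<leftarrow>as. (a(p := 0)) i * (a(p := 0)) j) = H i j"
        using ij as[of i j] by simp
      then show ?thesis
        unfolding list.map sum_list.Cons map_map o_def 0 by (simp add: H_def)
    qed
  qed
  then show ?case by blast
qed

lemma single_sum_list: "single \<alpha> (sum_list xs) = (\<Sum>x\<leftarrow>xs. single \<alpha> x)"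
  by (induction xs) (simp_all add: single_add)

text \<open>\<open>G\<close> is a Gram matrix of \<open>P\<close> indexed by monomials and matrix
  indices. A rank-one part \<open>a\<close> of \<open>G\<close> yields the vector whose entry
  \<open>s\<close> has the coefficients \<open>a (\<beta>, s)\<close>.\<close>

lemma sos_entries_gram:
  fixes B :: "('n \<Rightarrow>\<^sub>0 nat) set" and G :: "('n \<Rightarrow>\<^sub>0 nat) \<times> 't::finite \<Rightarrow> ('n \<Rightarrow>\<^sub>0 nat) \<times> 't \<Rightarrow> real"
  assumes "finite B" "\<And>p q. G p q = G q p"
    and "\<And>v. 0 \<le> (\<Sum>p\<in>B \<times> UNIV. \<Sum>q\<in>B \<times> UNIV. v p * v q * G p q)"
    and P: "\<And>s t. P s t = (\<Sum>\<beta>\<in>B. \<Sum>\<gamma>\<in>B. single (\<beta> + \<gamma>) (G (\<beta>, s) (\<gamma>, t)))"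
  shows "sos_entries P"
proof -
  obtain as where as: "\<And>p q. p \<in> B \<times> UNIV \<Longrightarrow> q \<in> B \<times> UNIV \<Longrightarrow> G p q = (\<Sum>a\<leftarrow>as. a p * a q)"
    using psd_sum_of_rank_one[of "B \<times> UNIV" G] assms by auto
  have "P s t = (\<Sum>q\<leftarrow>map (\<lambda>a s. \<Sum>\<beta>\<in>B. single \<beta> (a (\<beta>, s))) as. q s * q t)" for s t
  proof -
    have "P s t = (\<Sum>\<beta>\<in>B. \<Sum>\<gamma>\<in>B. \<Sum>a\<leftarrow>as. single \<beta> (a (\<beta>, s)) * single \<gamma> (a (\<gamma>, t)))"
      unfolding P by (intro sum.cong refl) (simp add: as single_sum_list mult_single o_def)
    also have "\<dots> = (\<Sum>a\<leftarrow>as. (\<Sum>\<beta>\<in>B. single \<beta> (a (\<beta>, s))) * (\<Sum>\<gamma>\<in>B. single \<gamma> (a (\<gamma>, t))))"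
      by (induction as) (simp_all add: sum.distrib sum_product)
    finally show ?thesis
      by (simp add: o_def)
  qed
  then show ?thesis
    unfolding sos_entries_def by blast
qed

lemma coeff_scale_single: "coeff_scale c (single \<alpha> a) = single \<alpha> (a * c \<alpha>)"
  by (rule poly_mapping_eqI) (simp add: lookup_single when_def)

text \<open>The Gram matrix of the Gaussian transform is a moment matrix, so integrating a pointwise
  nonnegative quadratic form shows that it is positive semidefinite.\<close>

lemma sos_entries_gauss_transform:
  fixes F :: "'t::finite \<Rightarrow> 't \<Rightarrow> 'n::finite mpoly"
  assumes sym: "\<And>s t. F s t = F t s"
    and nonneg: "\<And>x v. 0 \<le> (\<Sum>s\<in>UNIV. \<Sum>t\<in>UNIV. v s * v t * mpoly_eval (F s t) x)"
  shows "sos_entries (\<lambda>s t. gauss_transform (2 * K) (F s t))"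
proof -
  define l :: "'n mpoly" where "l = (\<Sum>i\<in>UNIV. mvar i) ^ K"
  define c where "c s t \<eta> = coeff_pairing (\<lambda>\<alpha>. gauss_moment (\<alpha> + \<eta>)) (F s t)" for s t \<eta>
  \<comment> \<open>Since \<open>(X_1 + ... + X_n)^(2K)\<close> is \<open>l * l\<close>, its
    monomials arise as sums \<open>\<beta> + \<gamma>\<close>; the moment depends only on that sum
    and is weighted by the coefficients of both factors.\<close>
  define G where "G = (\<lambda>(\<beta>, s) (\<gamma>, t). lookup l \<beta> * lookup l \<gamma> * c s t (\<beta> + \<gamma>))"
  show ?thesis
  proof (rule sos_entries_gram[of "keys l" G])
    show "finite (keys l)" by simp
    show "G p q = G q p" for p q
      by (cases p; cases q) (simp add: G_def c_def sym add.commute mult.commute)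
    fix s t
    have "(\<Sum>i\<in>UNIV. mvar i) ^ (2 * K) = l * l"
      by (simp add: l_def mult_2 power_add)
    also have "\<dots> = (\<Sum>\<beta>\<in>keys l. single \<beta> (lookup l \<beta>)) * (\<Sum>\<gamma>\<in>keys l. single \<gamma> (lookup l \<gamma>))"
      by (simp add: sum_single_lookup)
    also have "\<dots> = (\<Sum>\<beta>\<in>keys l. \<Sum>\<gamma>\<in>keys l. single (\<beta> + \<gamma>) (lookup l \<beta> * lookup l \<gamma>))"
      by (simp add: sum_product mult_single)
    finally show "gauss_transform (2 * K) (F s t) =
        (\<Sum>\<beta>\<in>keys l. \<Sum>\<gamma>\<in>keys l. single (\<beta> + \<gamma>) (G (\<beta>, s) (\<gamma>, t)))"
      by (simp add: gauss_transform_def coeff_scale_sum coeff_scale_single G_def c_def)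
  next
    fix v :: "('n \<Rightarrow>\<^sub>0 nat) \<times> 't \<Rightarrow> real"
    \<comment> \<open>The form at \<open>v\<close> is the Gaussian expectation of
      \<open>V^T F V\<close> for this vector of polynomials; the interchanges of sums below only
      regroup the indices into pairs.\<close>
    define V where "V s = (\<Sum>\<beta>\<in>keys l. single \<beta> (lookup l \<beta> * v (\<beta>, s)))" for s
    have "V s * V t * F s t = (\<Sum>\<beta>\<in>keys l. \<Sum>\<gamma>\<in>keys l.
        single (\<beta> + \<gamma>) (lookup l \<beta> * v (\<beta>, s) * (lookup l \<gamma> * v (\<gamma>, t))) * F s t)" for s t
      unfolding V_def sum_product unfolding mult_single sum_distrib_right ..
    moreover have "coeff_pairing gauss_moment (single \<eta> a * F s t) = a * c s t \<eta>" for \<eta> a s t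
      by (simp add: coeff_pairing_single_times c_def add.commute)
    ultimately have "coeff_pairing gauss_moment (V s * V t * F s t) =
        (\<Sum>\<beta>\<in>keys l. \<Sum>\<gamma>\<in>keys l. v (\<beta>, s) * v (\<gamma>, t) * G (\<beta>, s) (\<gamma>, t))" for s t
      by (simp only: coeff_pairing_sum G_def prod.case) (simp add: mult_ac)
    then have "coeff_pairing gauss_moment (\<Sum>s\<in>UNIV. \<Sum>t\<in>UNIV. V s * V t * F s t) =
        (\<Sum>s\<in>UNIV. \<Sum>t\<in>UNIV. \<Sum>\<beta>\<in>keys l. \<Sum>\<gamma>\<in>keys l. v (\<beta>, s) * v (\<gamma>, t) * G (\<beta>, s) (\<gamma>, t))"
      by (simp add: coeff_pairing_sum)
    also have "\<dots> = (\<Sum>s\<in>UNIV. \<Sum>\<beta>\<in>keys l. \<Sum>t\<in>UNIV. \<Sum>\<gamma>\<in>keys l. v (\<beta>, s) * v (\<gamma>, t) * G (\<beta>, s) (\<gamma>, t))"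
      by (intro sum.cong refl sum.swap)
    also have "\<dots> = (\<Sum>\<beta>\<in>keys l. \<Sum>s\<in>UNIV. \<Sum>\<gamma>\<in>keys l. \<Sum>t\<in>UNIV. v (\<beta>, s) * v (\<gamma>, t) * G (\<beta>, s) (\<gamma>, t))"
      by (subst sum.swap) (intro sum.cong refl sum.swap)
    also have "\<dots> = (\<Sum>p\<in>keys l \<times> UNIV. \<Sum>q\<in>keys l \<times> UNIV. v p * v q * G p q)"
      by (simp only: sum.cartesian_product')
    finally have "(\<Sum>p\<in>keys l \<times> UNIV. \<Sum>q\<in>keys l \<times> UNIV. v p * v q * G p q) =
        coeff_pairing gauss_moment (\<Sum>s\<in>UNIV. \<Sum>t\<in>UNIV. V s * V t * F s t)" by simp
    also have "\<dots> \<ge> 0"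
      using nonneg by (intro gauss_pairing_nonneg) (simp add: mpoly_eval_sum mpoly_eval_times)
    finally show "0 \<le> (\<Sum>p\<in>keys l \<times> UNIV. \<Sum>q\<in>keys l \<times> UNIV. v p * v q * G p q)" .
  qed
qed

section \<open>Small perturbations of a multiple of the identity Gram matrix\<close>

lemma exponent_split:
  fixes \<alpha> :: "'n::finite \<Rightarrow>\<^sub>0 nat"
  assumes "monom_degree \<alpha> = k + m"
  shows "\<exists>\<beta> \<gamma>. \<alpha> = \<beta> + \<gamma> \<and> monom_degree \<beta> = k \<and> monom_degree \<gamma> = m"
  using assms
proof (induction k arbitrary: \<alpha>)
  case 0
  then show ?case by (intro exI[of _ 0] exI[of _ \<alpha>]) simp
next
  case (Suc k)
  then obtain i where i: "lookup \<alpha> i \<noteq> 0"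
    by (metis lookup_zero poly_mapping_eqI monom_degree_zero add_is_0 nat.distinct(1))
  have "monom_degree (single i 1 + (\<alpha> - single i 1)) = Suc k + m"
    using Suc.prems by (simp only: unit_exponent_split[OF i])
  then have "monom_degree (\<alpha> - single i 1) = k + m"
    by (simp add: monom_degree_add)
  then obtain \<beta> \<gamma> where "\<alpha> - single i 1 = \<beta> + \<gamma>" "monom_degree \<beta> = k" "monom_degree \<gamma> = m"
    using Suc.IH by blast
  moreover from this have "\<alpha> = single i 1 + \<beta> + \<gamma>"
    using unit_exponent_split[OF i] by (metis add.assoc)
  ultimately show ?case
    by (intro exI[of _ "single i 1 + \<beta>"] exI[of _ \<gamma>]) (simp add: monom_degree_add)
qed

text \<open>Since \<open>|v i * v j|\<close> is at most half the sum of both squares, the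
  perturbation costs at most \<open>\<epsilon> * card I\<close> times the sum of all squares, which
  the diagonal covers.\<close>

lemma diagonally_dominant_nonneg:
  fixes H :: "'i \<Rightarrow> 'i \<Rightarrow> real"
  assumes "finite I" and H: "\<And>i j. \<bar>H i j\<bar> \<le> \<epsilon>" and "\<epsilon> * card I \<le> \<delta>"
  shows "0 \<le> (\<Sum>i\<in>I. \<Sum>j\<in>I. v i * v j * ((if i = j then \<delta> else 0) + H i j))"
proof -
  have "v i * v j * H i j \<ge> - (\<epsilon> * ((v i)\<^sup>2 + (v j)\<^sup>2) / 2)" for i j
  proof -
    have "\<bar>v i * v j * H i j\<bar> \<le> ((v i)\<^sup>2 + (v j)\<^sup>2) / 2 * \<epsilon>"
      unfolding abs_mult[of "v i * v j"]
    proof (rule mult_mono[OF _ H])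
      have "0 \<le> (\<bar>v i\<bar> - \<bar>v j\<bar>)\<^sup>2" by simp
      then show "\<bar>v i * v j\<bar> \<le> ((v i)\<^sup>2 + (v j)\<^sup>2) / 2"
        by (simp add: power2_diff abs_mult)
    qed simp_all
    then have "- (((v i)\<^sup>2 + (v j)\<^sup>2) / 2 * \<epsilon>) \<le> v i * v j * H i j" by linarith
    then show ?thesis by (simp add: mult.commute)
  qed
  then have "(\<Sum>i\<in>I. \<Sum>j\<in>I. v i * v j * H i j) \<ge> (\<Sum>i\<in>I. \<Sum>j\<in>I. - (\<epsilon> * ((v i)\<^sup>2 + (v j)\<^sup>2) / 2))"
    by (intro sum_mono)
  also have "(\<Sum>i\<in>I. \<Sum>j\<in>I. - (\<epsilon> * ((v i)\<^sup>2 + (v j)\<^sup>2) / 2)) = - (\<epsilon> * card I * (\<Sum>i\<in>I. (v i)\<^sup>2))"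
    by (simp add: sum_negf sum_divide_distrib[symmetric] sum_distrib_left[symmetric] sum.distrib)
  also have "\<dots> \<ge> - (\<delta> * (\<Sum>i\<in>I. (v i)\<^sup>2))"
    using assms(3) by (simp add: mult_right_mono sum_nonneg)
  finally have "0 \<le> \<delta> * (\<Sum>i\<in>I. (v i)\<^sup>2) + (\<Sum>i\<in>I. \<Sum>j\<in>I. v i * v j * H i j)" by simp
  also have "\<delta> * (\<Sum>i\<in>I. (v i)\<^sup>2) = (\<Sum>i\<in>I. \<Sum>j\<in>I. v i * v j * (if i = j then \<delta> else 0))"
    using assms(1) by (simp add: if_distrib sum_distrib_left power2_eq_square mult_ac cong: if_cong)
  finally show ?thesis
    by (simp add: sum.distrib[symmetric] distrib_left)
qed

text \<open>The identity is a Gram matrix of this form with respect to the monomials of degree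
  \<open>k\<close>.\<close>

definition square_monom_sum :: "nat \<Rightarrow> 'n::finite mpoly" where
  "square_monom_sum k = (\<Sum>\<beta> | monom_degree \<beta> = k. single (\<beta> + \<beta>) 1)"

lemma homogeneous_square_monom_sum: "homogeneous (2 * k) (square_monom_sum k)"
  unfolding square_monom_sum_def
  by (intro homogeneous_sum homogeneous_single) (simp add: monom_degree_add)

lemma sos_entries_perturbed_identity:
  fixes E :: "'t::finite \<Rightarrow> 't \<Rightarrow> 'n::finite mpoly"
  assumes sym: "\<And>s t. E s t = E t s" and hom: "\<And>s t. homogeneous (2 * k) (E s t)"
    and small: "\<And>s t \<alpha>. \<bar>lookup (E s t) \<alpha>\<bar> \<le> \<epsilon>"
    and card: "\<epsilon> * card ({\<beta> :: 'n \<Rightarrow>\<^sub>0 nat. monom_degree \<beta> = k} \<times> (UNIV :: 't set)) \<le> \<delta>"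
  shows "sos_entries (\<lambda>s t. (if s = t then single 0 \<delta> * square_monom_sum k else 0) + E s t)"
proof -
  define B where "B = {\<beta> :: 'n \<Rightarrow>\<^sub>0 nat. monom_degree \<beta> = k}"
  have fin: "finite B"
    unfolding B_def by (rule finite_monom_degree)
  \<comment> \<open>Each coefficient of \<open>E s t\<close> is spread evenly over the
    \<open>n \<alpha>\<close> ordered pairs of exponents of degree \<open>k\<close> with sum
    \<open>\<alpha>\<close>. The matrix \<open>H\<close> so obtained is symmetric, with entries
    bounded by \<open>\<epsilon>\<close>.\<close>
  define n where "n \<alpha> = real (card {p \<in> B \<times> B. fst p + snd p = \<alpha>})" for \<alpha>
  define H where "H = (\<lambda>(\<beta>, s) (\<gamma>, t). lookup (E s t) (\<beta> + \<gamma>) / n (\<beta> + \<gamma>))"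
  have \<epsilon>: "\<epsilon> \<ge> 0"
    using order_trans[OF abs_ge_zero small] .
  have H: "\<bar>H p q\<bar> \<le> \<epsilon>" for p q
  proof -
    obtain \<beta> s \<gamma> t where pq: "p = (\<beta>, s)" "q = (\<gamma>, t)" by fastforce
    \<comment> \<open>A count is at least 1, so that dividing by it does not enlarge, or it is 0 and
      the quotient is 0.\<close>
    have "real m = 0 \<or> real m \<ge> 1" for m :: nat
      by (cases m) simp_all
    then have "n (\<beta> + \<gamma>) = 0 \<or> n (\<beta> + \<gamma>) \<ge> 1"
      unfolding n_def by blast
    then have "\<bar>lookup (E s t) (\<beta> + \<gamma>)\<bar> / n (\<beta> + \<gamma>) \<le> \<epsilon>"
    proof
      assume "n (\<beta> + \<gamma>) \<ge> 1"
      moreover from this have "\<epsilon> * 1 \<le> \<epsilon> * n (\<beta> + \<gamma>)"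
        using \<epsilon> by (intro mult_left_mono)
      ultimately show ?thesis
        using small[of s t "\<beta> + \<gamma>"] by (simp add: pos_divide_le_eq)
    qed (simp add: \<epsilon>)
    then show ?thesis
      by (simp add: pq H_def n_def)
  qed
  show ?thesis
  proof (rule sos_entries_gram[of B "\<lambda>p q. (if p = q then \<delta> else 0) + H p q"])
    show "finite B" by (rule fin)
    show "(if p = q then \<delta> else 0) + H p q = (if q = p then \<delta> else 0) + H q p" for p q
      by (cases p; cases q) (auto simp: H_def sym add.commute)
    show "0 \<le> (\<Sum>p\<in>B \<times> UNIV. \<Sum>q\<in>B \<times> UNIV. v p * v q * ((if p = q then \<delta> else 0) + H p q))" for v
      using fin H card unfolding B_def[symmetric] by (intro diagonally_dominant_nonneg) auto
    fix s t :: 't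
    have diag: "(\<Sum>\<beta>\<in>B. \<Sum>\<gamma>\<in>B. single (\<beta> + \<gamma>) (if (\<beta>, s) = (\<gamma>, t) then \<delta> else 0)) =
        (if s = t then single 0 \<delta> * square_monom_sum k else 0)"
    proof (cases "s = t")
      case True
      have "(\<Sum>\<gamma>\<in>B. single (\<beta> + \<gamma>) (if (\<beta>, s) = (\<gamma>, t) then \<delta> else 0)) = single (\<beta> + \<beta>) \<delta>"
        if "\<beta> \<in> B" for \<beta>
      proof -
        have "(\<Sum>\<gamma>\<in>B. single (\<beta> + \<gamma>) (if (\<beta>, s) = (\<gamma>, t) then \<delta> else 0)) =
            (\<Sum>\<gamma>\<in>B. if \<gamma> = \<beta> then single (\<beta> + \<gamma>) \<delta> else 0)"
          using True by (intro sum.cong) auto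
        then show ?thesis using fin that by simp
      qed
      then show ?thesis
        using True by (simp add: square_monom_sum_def B_def sum_distrib_left mult_single)
    qed simp
    have "(\<Sum>\<beta>\<in>B. \<Sum>\<gamma>\<in>B. single (\<beta> + \<gamma>) (H (\<beta>, s) (\<gamma>, t))) = E s t"
    proof (rule poly_mapping_eqI)
      fix \<alpha>
      have "lookup (\<Sum>\<beta>\<in>B. \<Sum>\<gamma>\<in>B. single (\<beta> + \<gamma>) (H (\<beta>, s) (\<gamma>, t))) \<alpha> =
          (\<Sum>p\<in>B \<times> B. if fst p + snd p = \<alpha> then lookup (E s t) \<alpha> / n \<alpha> else 0)"
        unfolding sum.cartesian_product lookup_sum
        by (intro sum.cong) (auto simp: lookup_single when_def H_def)
      also have "\<dots> = n \<alpha> * (lookup (E s t) \<alpha> / n \<alpha>)"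
        using fin by (simp add: sum.If_cases n_def Int_def)
      also have "\<dots> = lookup (E s t) \<alpha>"
      proof (cases "lookup (E s t) \<alpha> = 0")
        \<comment> \<open>A nonzero coefficient has degree \<open>2k\<close>, so its exponent splits
          into two of degree \<open>k\<close>; hence \<open>n \<alpha>\<close> is nonzero and
          cancels.\<close>
        case False
        then have "monom_degree \<alpha> = k + k"
          using hom[of s t] by (simp add: homogeneous_def)
        then obtain \<beta> \<gamma> where "\<alpha> = \<beta> + \<gamma>" "monom_degree \<beta> = k" "monom_degree \<gamma> = k"
          using exponent_split by blast
        then have "(\<beta>, \<gamma>) \<in> {p \<in> B \<times> B. fst p + snd p = \<alpha>}"
          by (simp add: B_def)
        then have "n \<alpha> \<noteq> 0"
          using fin by (auto simp: n_def card_eq_0_iff)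
        then show ?thesis by simp
      qed simp
      finally show "lookup (\<Sum>\<beta>\<in>B. \<Sum>\<gamma>\<in>B. single (\<beta> + \<gamma>) (H (\<beta>, s) (\<gamma>, t))) \<alpha> = lookup (E s t) \<alpha>" .
    qed
    with diag show "(if s = t then single 0 \<delta> * square_monom_sum k else 0) + E s t =
        (\<Sum>\<beta>\<in>B. \<Sum>\<gamma>\<in>B. single (\<beta> + \<gamma>) ((if (\<beta>, s) = (\<gamma>, t) then \<delta> else 0) + H (\<beta>, s) (\<gamma>, t)))"
      by (simp only: single_add sum.distrib)
  qed
qed

subsection \<open>Positivity on the sphere\<close>

text \<open>On the unit sphere all coordinates, hence all squared monomials, are at most 1 in
  absolute value.\<close>

lemma square_monom_sum_le_card:
  fixes x :: "real ^ 'n::finite"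
  assumes "norm x = 1"
  shows "mpoly_eval (square_monom_sum k) x \<le> card {\<beta> :: 'n \<Rightarrow>\<^sub>0 nat. monom_degree \<beta> = k}"
proof -
  have "monom_value x (\<beta> + \<beta>) \<le> 1" for \<beta> :: "'n \<Rightarrow>\<^sub>0 nat"
  proof -
    have "\<bar>monom_value x \<beta>\<bar> \<le> 1"
      unfolding monom_value_def abs_prod power_abs
      using component_le_norm_cart[of x] assms by (intro prod_le_1) (simp add: power_le_one)
    then show ?thesis
      by (simp add: monom_value_add abs_square_le_1 flip: power2_eq_square)
  qed
  then have "mpoly_eval (square_monom_sum k) x \<le> (\<Sum>\<beta> | monom_degree (\<beta> :: 'n \<Rightarrow>\<^sub>0 nat) = k. 1)"
    unfolding square_monom_sum_def mpoly_eval_sum mpoly_eval_single by (intro sum_mono) simp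
  then show ?thesis by simp
qed

definition quad_eval :: "('t::finite \<Rightarrow> 't \<Rightarrow> 'n::finite mpoly) \<Rightarrow> real ^ 'n \<Rightarrow> real ^ 't \<Rightarrow> real" where
  "quad_eval P x v = (\<Sum>s\<in>UNIV. \<Sum>t\<in>UNIV. v $ s * v $ t * mpoly_eval (P s t) x)"

lemma inner_pmat_eval: "v \<bullet> (pmat_eval F x *v v) = quad_eval (\<lambda>s t. F $ s $ t) x v"
  by (simp add: quad_eval_def pmat_eval_def inner_vec_def matrix_vector_mult_def sum_distrib_left mult_ac)

lemma quad_eval_scale:
  assumes "\<And>s t. homogeneous d (P s t)"
  shows "quad_eval P (a *\<^sub>R x) (b *\<^sub>R v) = a ^ d * b\<^sup>2 * quad_eval P x v"
  by (simp add: quad_eval_def mpoly_eval_scale[OF assms] sum_distrib_left power2_eq_square mult_ac)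

lemma unit_vector_multiple:
  fixes x :: "real ^ 'n"
  obtains u where "norm u = 1" "x = norm x *\<^sub>R u"
proof (cases "x = 0")
  case True
  then show ?thesis
    by (intro that[of "axis undefined 1"]) simp_all
next
  case False
  then show ?thesis
    by (intro that[of "x /\<^sub>R norm x"]) simp_all
qed

lemma quad_eval_nonneg_if_nonneg_on_unit_vectors:
  assumes "\<And>s t. homogeneous (2 * k) (P s t)"
    and "\<And>x v. norm x = 1 \<Longrightarrow> norm v = 1 \<Longrightarrow> 0 \<le> quad_eval P x v"
  shows "0 \<le> quad_eval P x v"
proof -
  obtain x' v' where x': "norm x' = 1" "x = norm x *\<^sub>R x'" and v': "norm v' = 1" "v = norm v *\<^sub>R v'"
    by (metis unit_vector_multiple)
  have "quad_eval P (norm x *\<^sub>R x') (norm v *\<^sub>R v') = norm x ^ (2 * k) * (norm v)\<^sup>2 * quad_eval P x' v'"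
    by (rule quad_eval_scale[OF assms(1)])
  also have "\<dots> \<ge> 0"
    using assms(2)[OF x'(1) v'(1)] by simp
  finally show ?thesis
    using x'(2) v'(2) by simp
qed

text \<open>A continuous function attains its minimum on the compact product of the two unit
  spheres, and its values there are positive.\<close>

lemma quad_eval_lower_bound:
  fixes P :: "'t::finite \<Rightarrow> 't \<Rightarrow> 'n::finite mpoly"
  assumes "\<And>x v. x \<noteq> 0 \<Longrightarrow> v \<noteq> 0 \<Longrightarrow> 0 < quad_eval P x v"
  obtains m where "m > 0" "\<And>x v. norm x = 1 \<Longrightarrow> norm v = 1 \<Longrightarrow> m \<le> quad_eval P x v"
proof -
  let ?S = "sphere (0 :: real ^ 'n) 1 \<times> sphere (0 :: real ^ 't) 1"
  have "compact ?S"
    by (intro compact_Times compact_sphere)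
  moreover have "?S \<noteq> {}"
    by (auto intro: exI[of _ "axis undefined 1"])
  moreover have "continuous_on ?S (\<lambda>z. quad_eval P (fst z) (snd z))"
    unfolding quad_eval_def by (intro continuous_intros)
  ultimately have "\<exists>z\<in>?S. \<forall>w\<in>?S. quad_eval P (fst z) (snd z) \<le> quad_eval P (fst w) (snd w)"
    by (rule continuous_attains_inf)
  then obtain y u where yu: "norm y = 1" "norm u = 1"
    and min: "\<And>x v. norm x = 1 \<Longrightarrow> norm v = 1 \<Longrightarrow> quad_eval P y u \<le> quad_eval P x v"
    by auto
  have "y \<noteq> 0" "u \<noteq> 0"
    using yu by auto
  then have "quad_eval P y u > 0"
    by (rule assms)
  then show ?thesis
    using min by (rule that)
qed

lemma even_degree_if_pos_def:
  fixes F :: "('n::finite, 't::finite) pmat"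
  assumes hom: "\<And>s t. homogeneous d (F $ s $ t)"
    and pd: "\<And>x :: real ^ 'n. x \<noteq> 0 \<Longrightarrow> pos_def_matrix (pmat_eval F x)"
  shows "even d"
proof (rule ccontr)
  assume "odd d"
  let ?e = "axis undefined 1 :: real ^ 'n" and ?v = "axis undefined 1 :: real ^ 't"
  let ?Q = "quad_eval (\<lambda>s t. F $ s $ t)"
  have pos: "0 < ?Q x ?v" if "x \<noteq> 0" for x
    using pd[OF that] by (simp add: pos_def_matrix_def inner_pmat_eval[symmetric])
  have "?Q ((- 1) *\<^sub>R ?e) (1 *\<^sub>R ?v) = (- 1) ^ d * 1\<^sup>2 * ?Q ?e ?v"
    by (rule quad_eval_scale) (rule hom)
  then have "?Q (- ?e) ?v = - ?Q ?e ?v"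
    using \<open>odd d\<close> by simp
  then show False
    using pos[of ?e] pos[of "- ?e"] by simp
qed

text \<open>Only the finitely many exponents of degree \<open>d\<close> can carry nonzero
  coefficients, so coefficientwise convergence is uniform.\<close>

lemma eventually_lookup_small:
  fixes E :: "nat \<Rightarrow> 't::finite \<Rightarrow> 't \<Rightarrow> 'n::finite mpoly"
  assumes hom: "\<And>N s t. homogeneous d (E N s t)"
    and lim: "\<And>s t \<alpha>. (\<lambda>N. lookup (E N s t) \<alpha>) \<longlonglongrightarrow> 0" and "\<epsilon> > 0"
  shows "\<forall>\<^sub>F N in sequentially. \<forall>s t \<alpha>. \<bar>lookup (E N s t) \<alpha>\<bar> \<le> \<epsilon>"
proof -
  have "\<forall>\<^sub>F N in sequentially. \<bar>lookup (E N s t) \<alpha>\<bar> \<le> \<epsilon>" for s t \<alpha>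
    using tendstoD[OF lim \<open>\<epsilon> > 0\<close>, of s t \<alpha>] by (rule eventually_mono) simp
  then have "\<forall>\<^sub>F N in sequentially. \<forall>s\<in>UNIV. \<forall>t\<in>UNIV. \<forall>\<alpha>\<in>{\<alpha>. monom_degree \<alpha> = d}.
      \<bar>lookup (E N s t) \<alpha>\<bar> \<le> \<epsilon>"
    by (intro eventually_ball_finite ballI finite_monom_degree) auto
  then show ?thesis
  proof (rule eventually_mono)
    fix N
    assume small: "\<forall>s\<in>UNIV. \<forall>t\<in>UNIV. \<forall>\<alpha>\<in>{\<alpha>. monom_degree \<alpha> = d}. \<bar>lookup (E N s t) \<alpha>\<bar> \<le> \<epsilon>"
    show "\<forall>s t \<alpha>. \<bar>lookup (E N s t) \<alpha>\<bar> \<le> \<epsilon>"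
    proof (intro allI)
      fix s t \<alpha>
      show "\<bar>lookup (E N s t) \<alpha>\<bar> \<le> \<epsilon>"
        using small hom[of N s t] \<open>\<epsilon> > 0\<close>
        by (cases "lookup (E N s t) \<alpha> = 0") (simp_all add: homogeneous_def)
    qed
  qed
qed

section \<open>Choice of the constants and assembly of the sum of squares\<close>

theorem corollary4p3:
  fixes F :: "('n::finite, 't::finite) pmat" and d :: nat
  assumes "transpose F = F"
    and "homogeneous_pmat d F"
    and "\<And>x :: real ^ 'n. x \<noteq> 0 \<Longrightarrow> pos_def_matrix (pmat_eval F x)"
  shows "\<exists>N::nat. N > 0 \<and> pmat_scale ((\<Sum>i\<in>UNIV. mvar i ^ 2) ^ N) F \<in> sos_pmats"
proof -
  have hom_d: "homogeneous d (F $ s $ t)" for s t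
    using assms(2) by (simp add: homogeneous_pmat_iff homogeneous_def in_keys_iff)
  obtain k where d: "d = 2 * k"
    using even_degree_if_pos_def[OF hom_d assms(3)] by (rule evenE)
  have hom: "homogeneous (2 * k) (F $ s $ t)" for s t
    using hom_d by (simp add: d)
  have sym: "F $ s $ t = F $ t $ s" for s t
  proof -
    have "transpose F $ s $ t = F $ t $ s"
      by (simp add: transpose_def)
    then show ?thesis
      by (simp only: assms(1))
  qed
  let ?B = "{\<beta> :: 'n \<Rightarrow>\<^sub>0 nat. monom_degree \<beta> = k}"
  obtain m where m: "m > 0"
    "\<And>x v. norm x = 1 \<Longrightarrow> norm v = 1 \<Longrightarrow> m \<le> quad_eval (\<lambda>s t. F $ s $ t) x v"
    using quad_eval_lower_bound[of "\<lambda>s t. F $ s $ t"] assms(3)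
    unfolding inner_pmat_eval[symmetric] pos_def_matrix_def by metis
  \<comment> \<open>On the unit sphere \<open>\<delta>\<close> times
    \<open>square_monom_sum k\<close> is then at most \<open>m\<close>, so subtracting it on the
    diagonal keeps \<open>P\<close> positive semidefinite. The \<open>+ 1\<close> makes the
    denominator positive.\<close>
  define \<delta> where "\<delta> = m / (card ?B + 1)"
  have \<delta>: "\<delta> > 0" "\<delta> * card ?B \<le> m"
    using m(1) by (simp_all add: \<delta>_def field_simps)
  define P where "P s t = F $ s $ t - (if s = t then single 0 \<delta> * square_monom_sum k else 0)" for s t
  have P_sym: "P s t = P t s" for s t
    by (simp add: P_def sym[of s t])
  have P_hom: "homogeneous (2 * k) (P s t)" for s t
    unfolding P_def using hom homogeneous_square_monom_sum
    by (auto intro!: homogeneous_diff homogeneous_const_times homogeneous_zero)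
  have P_eval: "quad_eval P x v =
      quad_eval (\<lambda>s t. F $ s $ t) x v - \<delta> * mpoly_eval (square_monom_sum k) x * (norm v)\<^sup>2" for x v
  proof -
    have "mpoly_eval (P s t) x = mpoly_eval (F $ s $ t) x -
        (if s = t then \<delta> * mpoly_eval (square_monom_sum k) x else 0)" for s t
      by (simp add: P_def mpoly_eval_diff mpoly_eval_times mpoly_eval_single monom_value_def)
        (simp add: mpoly_eval_def)
    then have "quad_eval P x v = quad_eval (\<lambda>s t. F $ s $ t) x v -
        (\<Sum>s\<in>UNIV. \<Sum>t\<in>UNIV. v $ s * v $ t * (if s = t then \<delta> * mpoly_eval (square_monom_sum k) x else 0))"
      by (simp add: quad_eval_def right_diff_distrib sum_subtractf)
    also have "(\<Sum>s\<in>UNIV. \<Sum>t\<in>UNIV. v $ s * v $ t * (if s = t then \<delta> * mpoly_eval (square_monom_sum k) x else 0))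
        = \<delta> * mpoly_eval (square_monom_sum k) x * (norm v)\<^sup>2"
      by (simp add: if_distrib sum_distrib_left power2_norm_eq_inner inner_vec_def mult_ac cong: if_cong)
    finally show ?thesis .
  qed
  have P_nonneg: "0 \<le> quad_eval P x v" for x v
  proof (rule quad_eval_nonneg_if_nonneg_on_unit_vectors[OF P_hom])
    fix x :: "real ^ 'n" and v :: "real ^ 't"
    assume "norm x = 1" "norm v = 1"
    moreover from this have "\<delta> * mpoly_eval (square_monom_sum k) x \<le> \<delta> * card ?B"
      using \<delta>(1) by (intro mult_left_mono square_monom_sum_le_card) simp_all
    ultimately show "0 \<le> quad_eval P x v"
      using m(2)[of x v] \<delta>(2) by (simp add: P_eval)
  qed
  define good where "good p T \<longleftrightarrow> (\<forall>N. homogeneous (2 * k) (T N)) \<and> (\<forall>\<eta>. (\<lambda>N. lookup (T N) \<eta>) \<longlonglongrightarrow> lookup p \<eta>) \<and>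
     (\<forall>N. gauss_transform (2 * N + 2 * k) p =
       single 0 (fact (2 * N + 2 * k) / (2 ^ N * fact N)) * (norm_square ^ N * T N))"
    for p :: "'n mpoly" and T
  \<comment> \<open>\<open>T\<close> is chosen as a function of the polynomial, not of
    \<open>s\<close> and \<open>t\<close>, so the remainder \<open>E\<close> inherits the symmetry
    of \<open>P\<close>.\<close>
  obtain T where "\<And>p. homogeneous (2 * k) p \<Longrightarrow> good p (T p)"
    using gauss_transform_asymptotics[of "2 * k"] unfolding good_def by metis
  then have T: "good (P s t) (T (P s t))" for s t
    using P_hom by blast
  define E where "E N s t = P s t - T (P s t) N" for N s t
  have E_hom: "homogeneous (2 * k) (E N s t)" for N s t
    unfolding E_def using T[of s t] P_hom by (intro homogeneous_diff) (auto simp: good_def)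
  have E_lim: "(\<lambda>N. lookup (E N s t) \<eta>) \<longlonglongrightarrow> 0" for s t \<eta>
    unfolding E_def lookup_minus using T[of s t] by (auto simp: good_def intro!: tendsto_eq_intros)
  \<comment> \<open>With coefficients below this bound, the remainder is dominated by
    \<open>\<delta>\<close> times the identity Gram matrix.\<close>
  define \<epsilon> where "\<epsilon> = \<delta> / (card (?B \<times> (UNIV :: 't set)) + 1)"
  have \<epsilon>: "\<epsilon> > 0" "\<epsilon> * card (?B \<times> (UNIV :: 't set)) \<le> \<delta>"
    using \<delta>(1) by (simp_all add: \<epsilon>_def field_simps add_pos_nonneg)
  have "\<forall>\<^sub>F N in sequentially. \<forall>s t \<alpha>. \<bar>lookup (E N s t) \<alpha>\<bar> \<le> \<epsilon>"
    using E_hom E_lim \<epsilon>(1) by (rule eventually_lookup_small)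
  then obtain N where N: "N > 0" "\<And>s t \<alpha>. \<bar>lookup (E N s t) \<alpha>\<bar> \<le> \<epsilon>"
    using eventually_conj[OF eventually_gt_at_top[of "0 :: nat"]]
    by (metis (no_types, lifting) eventually_happens' sequentially_bot)
  have "sos_entries (\<lambda>s t. gauss_transform (2 * (N + k)) (P s t))"
    using P_nonneg[unfolded quad_eval_def, of "vec_lambda _"]
    by (intro sos_entries_gauss_transform) (auto simp: P_sym)
  \<comment> \<open>Division by the positive constant of the asymptotic formula, at the exponent
    \<open>2N + 2k\<close>.\<close>
  then have "sos_entries (\<lambda>s t. single 0 (2 ^ N * fact N / fact (2 * N + 2 * k)) * gauss_transform (2 * (N + k)) (P s t))"
    by (rule sos_entries_const_times) simp
  moreover have "single 0 (2 ^ N * fact N / fact (2 * N + 2 * k)) * gauss_transform (2 * (N + k)) (P s t) =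
      norm_square ^ N * T (P s t) N" for s t
  proof -
    have "gauss_transform (2 * (N + k)) (P s t) =
        single 0 (fact (2 * N + 2 * k) / (2 ^ N * fact N)) * (norm_square ^ N * T (P s t) N)"
      using T[of s t] by (simp add: good_def)
    then show ?thesis
      by (simp only: mult.assoc[symmetric] mult_single) simp
  qed
  ultimately have "sos_entries (\<lambda>s t. norm_square ^ N * T (P s t) N)" by simp
  moreover have "sos_entries (\<lambda>s t. norm_square ^ N *
      ((if s = t then single 0 \<delta> * square_monom_sum k else 0) + E N s t))"
    using E_hom N(2) \<epsilon>(2)
    by (intro sos_entries_norm_square_power_times sos_entries_perturbed_identity) (auto simp: E_def P_sym)
  ultimately have "sos_entries (\<lambda>s t. norm_square ^ N * T (P s t) N + norm_square ^ N *
      ((if s = t then single 0 \<delta> * square_monom_sum k else 0) + E N s t))"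
    by (rule sos_entries_add)
  \<comment> \<open>The two summands add up to \<open>F\<close>: the terms
    \<open>T (P s t) N\<close> cancel, and \<open>P\<close> plus its diagonal correction is
    \<open>F\<close>.\<close>
  moreover have "norm_square ^ N * T (P s t) N + norm_square ^ N *
      ((if s = t then single 0 \<delta> * square_monom_sum k else 0) + E N s t) =
      pmat_scale (norm_square ^ N) F $ s $ t" for s t
    by (simp add: pmat_scale_def E_def P_def distrib_left[symmetric])
  ultimately have "pmat_scale (norm_square ^ N) F \<in> sos_pmats"
    by (intro sos_pmats_if_sos_entries) simp
  then show ?thesis
    using N(1) unfolding norm_square_def by blast
qed

end
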